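(* Let $n\ge 2$, $N\ge n$ and let $(\mathcal T_0,\mathfrak c)$ be an $(N{+}1)$-colored initial triangulation of a polyhedral domain $\Omega\subset\mathbb R^n$. Let $0<d\le D<\infty$ be constants such that $d\,2^{-\ell(T)}\le \operatorname{diam}(T)\le D\,2^{-\ell(T)}$ for all $T\in\mathbb T$. Consider an adaptive loop producing triangulations $\mathcal T_0,\mathcal T_1,\dots\in\mathbb B$ and sets of marked simplices $\mathcal M_\ell\subset\mathcal T_\ell$ with $\mathcal T_{\ell+1}=\mathrm{Refine}(\mathcal T_\ell,\mathcal M_\ell)$. Then there is a constant $C_{\mathrm{BDV}}<\infty$ such that $$\#\mathcal T_L-\#\mathcal T_0\le C_{\mathrm{BDV}}\sum_{\ell=0}^{L-1}\#\mathcal M_\ell\qquad\text{for all }L\in\mathbb N,$$ and $C_{\mathrm{BDV}}\le C\,N^n$, where $C<\infty$ depends only on $n$, the ratio $D/d$ and the shape regularity of $\mathcal T_0$, but not on $N$.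
   Context: An $n$-simplex is the convex hull of $n+1$ affinely independent points of $\mathbb R^n$ (its vertices); an $m$-subsimplex is the convex hull of $m+1$ of its vertices. A (conforming) triangulation of $\Omega$ is a finite set of closed $n$-simplices with pairwise disjoint interiors covering $\overline\Omega$ such that any two intersect in the empty set or in a common subsimplex. $\mathcal V(\mathcal T)$, $\mathcal E(\mathcal T)$ denote vertices and edges. An $(N{+}1)$-colored triangulation is a triangulation $\mathcal T_0$ with a map $\mathfrak c:\mathcal V(\mathcal T_0)\to\{0,\dots,N\}$, $N\ge n$, such that the vertices of each $T\in\mathcal T_0$ have pairwise distinct colors. Generations: every vertex $v$ carries an integer generation $g(v)$; its level $\ell(v)\in\mathbb Z$ and type $t(v)\in\{1,\dots,N\}$ are defined by $g(v)=N(\ell(v)-1)+t(v)$. Initial vertices have $g(v)=-\mathfrak c(v)$. Vertices of each arising simplex have distinct generations, and we write $S=[v_0,\dots,v_m]$ with $g(v_0)>\dots>g(v_m)$. Bisection rule for such an $m$-simplex ($1\le m\le n$): if $\ell(v_m)\ne\ell(v_{m-1})$, the bisection edge is $\mathrm{bse}(S)=[v_{m-1},v_m]$ and its midpoint $\mathrm{bsv}(S)$ gets generation $g(v_{m-1})+N$; otherwise, with $j=\min\{k:\ell(v_k)=\ell(v_m)\}$, $\mathrm{bse}(S)=[v_j,v_m]$ and $g(\mathrm{bsv}(S))=g(v_m)+2N+1-t(v_j)$. Bisecting an $n$-simplex $T$ with $\mathrm{bse}(T)=[a,b]$ gives two children obtained by replacing $a$, resp. $b$, by the midpoint. Closure $\mathrm{Refine}(\mathcal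 T,T)$ for $T\in\mathcal T$: let $e=\mathrm{bse}(T)$ and $\omega(e)$ the simplices of $\mathcal T$ having $e$ as an edge; if some $T'\in\omega(e)$ has $\mathrm{bse}(T')\ne e$, return $\mathrm{Refine}(\mathrm{Refine}(\mathcal T,T'),T)$; otherwise replace every simplex of $\omega(e)$ by its two children. $\mathbb B$ is the set of triangulations obtained from $\mathcal T_0$ by finitely many such refinements, $\mathbb T$ the set of all simplices occurring in elements of $\mathbb B$. For a simplex $S$, $\ell(S)=\max_{v\in\mathcal V(S)}\ell(v)$. For $\mathcal M\subset\mathcal T$, $\mathrm{Refine}(\mathcal T,\mathcal M)$ is the coarsest common refinement of all $\mathrm{Refine}(\mathcal T,M)$, $M\in\mathcal M$. Shape regularity of a simplex $S$ is $\gamma(S)=R(S)/r(S)$ with $R(S)$ the diameter of the smallest ball containing $S$ and $r(S)$ the diameter of the largest ball contained in $S$. *)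

theory Defs
  imports "HOL-Analysis.Analysis"
begin

(* A vertex is a point together with its (integer) generation.
   A simplex is the finite set of its (labelled) vertices. *)
type_synonym 'a vtx = "'a \<times> int"
type_synonym 'a splx = "'a vtx set"

(* level and type: g = N (lev - 1) + vtype, vtype \<in> {1..N} *)
definition lev :: "nat \<Rightarrow> int \<Rightarrow> int" where
  "lev N g = (g - 1) div int N + 1"

definition vtype :: "nat \<Rightarrow> int \<Rightarrow> int" where
  "vtype N g = (g - 1) mod int N + 1"

definition gens_desc :: "'a splx \<Rightarrow> int list" where
  "gens_desc S = rev (sorted_list_of_set (snd ` S))"

definition vk :: "'a splx \<Rightarrow> nat \<Rightarrow> 'a vtx" where
  "vk S k = (THE v. v \<in> S \<and> snd v = gens_desc S ! k)"

(* bisection data: (endpoint a, endpoint b, generation of midpoint) *)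
definition bisec_data :: "nat \<Rightarrow> 'a splx \<Rightarrow> 'a vtx \<times> 'a vtx \<times> int" where
  "bisec_data N S =
    (let m = card S - 1; v = vk S in
     if lev N (snd (v m)) \<noteq> lev N (snd (v (m - 1)))
     then (v (m - 1), v m, snd (v (m - 1)) + int N)
     else (let j = (LEAST k. lev N (snd (v k)) = lev N (snd (v m))) in
           (v j, v m, snd (v m) + 2 * int N + 1 - vtype N (snd (v j)))))"

definition bse :: "nat \<Rightarrow> 'a splx \<Rightarrow> 'a splx" where
  "bse N S = (case bisec_data N S of (a, b, _) \<Rightarrow> {a, b})"

definition bsv :: "nat \<Rightarrow> ('a::real_vector) splx \<Rightarrow> 'a vtx" where
  "bsv N S = (case bisec_data N S of (a, b, g) \<Rightarrow> ((1/2) *\<^sub>R (fst a + fst b), g))"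

definition children :: "nat \<Rightarrow> ('a::real_vector) splx \<Rightarrow> 'a splx set" where
  "children N T = (case bisec_data N T of (a, b, _) \<Rightarrow>
     {insert (bsv N T) (T - {a}), insert (bsv N T) (T - {b})})"

definition patch :: "'a splx set \<Rightarrow> 'a splx \<Rightarrow> 'a splx set" where
  "patch \<T> e = {T' \<in> \<T>. e \<subseteq> T'}"

(* Refine(\<T>, T) as a relation:  refine1 N \<T> T \<T>'  means  \<T>' = Refine(\<T>, T) *)
inductive refine1 :: "nat \<Rightarrow> ('a::real_vector) splx set \<Rightarrow> 'a splx \<Rightarrow> 'a splx set \<Rightarrow> bool"
  for N :: nat where
  base: "T \<in> \<T> \<Longrightarrow> (\<forall>T'\<in>patch \<T> (bse N T). bse N T' = bse N T) \<Longrightarrow>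
     refine1 N \<T> T ((\<T> - patch \<T> (bse N T)) \<union> \<Union> (children N ` patch \<T> (bse N T)))"
| recur: "T \<in> \<T> \<Longrightarrow> T' \<in> patch \<T> (bse N T) \<Longrightarrow> bse N T' \<noteq> bse N T \<Longrightarrow>
     refine1 N \<T> T' \<T>1 \<Longrightarrow> refine1 N \<T>1 T \<T>2 \<Longrightarrow> refine1 N \<T> T \<T>2"

inductive_set BB :: "nat \<Rightarrow> ('a::real_vector) splx set \<Rightarrow> 'a splx set set"
  for N :: nat and \<T>0 :: "'a splx set" where
  init: "\<T>0 \<in> BB N \<T>0"
| step: "\<T> \<in> BB N \<T>0 \<Longrightarrow> T \<in> \<T> \<Longrightarrow> refine1 N \<T> T \<T>' \<Longrightarrow> \<T>' \<in> BB N \<T>0"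

definition TT :: "nat \<Rightarrow> ('a::real_vector) splx set \<Rightarrow> 'a splx set" where
  "TT N \<T>0 = \<Union> (BB N \<T>0)"

definition hull_of :: "('a::real_vector) splx \<Rightarrow> 'a set" where
  "hull_of S = convex hull (fst ` S)"

definition refines :: "('a::real_vector) splx set \<Rightarrow> 'a splx set \<Rightarrow> bool" where
  "refines \<X> \<Y> \<longleftrightarrow> (\<forall>A\<in>\<X>. \<exists>B\<in>\<Y>. hull_of A \<subseteq> hull_of B)"

(* Refine(\<T>, \<M>): coarsest common refinement (within \<bbbB>) of all Refine(\<T>, M), M \<in> \<M>
   (and of \<T> itself, so that Refine(\<T>, {}) = \<T>) *)
definition refine_marked :: "nat \<Rightarrow> ('a::real_vector) splx set \<Rightarrow> 'a splx set \<Rightarrow> 'a splx set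
    \<Rightarrow> 'a splx set \<Rightarrow> bool" where
  "refine_marked N \<T>0 \<T> \<M> \<T>' \<longleftrightarrow>
     (\<exists>R. (\<forall>M\<in>\<M>. refine1 N \<T> M (R M)) \<and>
          \<T>' \<in> BB N \<T>0 \<and> refines \<T>' \<T> \<and> (\<forall>M\<in>\<M>. refines \<T>' (R M)) \<and>
          (\<forall>\<X>\<in>BB N \<T>0. refines \<X> \<T> \<and> (\<forall>M\<in>\<M>. refines \<X> (R M)) \<longrightarrow> refines \<X> \<T>'))"

definition lev_s :: "nat \<Rightarrow> 'a splx \<Rightarrow> int" where
  "lev_s N S = Max ((\<lambda>v. lev N (snd v)) ` S)"

definition conforming_triangulation :: "nat \<Rightarrow> ('a::euclidean_space) set set \<Rightarrow> 'a set \<Rightarrow> bool" where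
  "conforming_triangulation n \<G> X \<longleftrightarrow>
     finite \<G> \<and>
     (\<forall>P\<in>\<G>. finite P \<and> card P = n + 1 \<and> \<not> affine_dependent P) \<and>
     (\<forall>P\<in>\<G>. \<forall>Q\<in>\<G>. P \<noteq> Q \<longrightarrow> interior (convex hull P) \<inter> interior (convex hull Q) = {}) \<and>
     \<Union> ((\<lambda>P. convex hull P) ` \<G>) = X \<and>
     (\<forall>P\<in>\<G>. \<forall>Q\<in>\<G>. convex hull P \<inter> convex hull Q = {} \<or>
        (\<exists>S. S \<noteq> {} \<and> S \<subseteq> P \<and> S \<subseteq> Q \<and> convex hull P \<inter> convex hull Q = convex hull S))"

definition polyhedral_domain :: "('a::euclidean_space) set \<Rightarrow> bool" where
  "polyhedral_domain \<Omega> \<longleftrightarrow> open \<Omega> \<and> connected \<Omega> \<and> \<Omega> \<noteq> {} \<and>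
     (\<exists>\<P>. finite \<P> \<and> (\<forall>P\<in>\<P>. polytope P) \<and> closure \<Omega> = \<Union> \<P>)"

definition colored :: "nat \<Rightarrow> ('a::euclidean_space) set set \<Rightarrow> ('a \<Rightarrow> nat) \<Rightarrow> bool" where
  "colored N \<G> c \<longleftrightarrow> (\<forall>P\<in>\<G>. \<forall>p\<in>P. c p \<le> N) \<and> (\<forall>P\<in>\<G>. inj_on c P)"

definition initial_labelled :: "('a set set) \<Rightarrow> ('a \<Rightarrow> nat) \<Rightarrow> 'a splx set" where
  "initial_labelled \<G> c = (\<lambda>P. (\<lambda>p. (p, - int (c p))) ` P) ` \<G>"

definition circum_diam :: "('a::real_normed_vector) set \<Rightarrow> real" where
  "circum_diam K = 2 * Inf {\<rho>. \<exists>x. K \<subseteq> cball x \<rho>}"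

definition in_diam :: "('a::real_normed_vector) set \<Rightarrow> real" where
  "in_diam K = 2 * Sup {\<rho>. \<exists>x. cball x \<rho> \<subseteq> K}"

definition shape_reg :: "('a::real_normed_vector) set \<Rightarrow> real" where
  "shape_reg K = circum_diam K / in_diam K"

end

theory Submission
  imports Defs
begin

text \<open>
  The bisection edge of a simplex is the unique edge whose midpoint gets the smallest generation.
  Hence the recursive calls of Refine have bisection vertices of strictly decreasing generation, so
  that at most \<open>N\<close> of them belong to one level, and a simplex \<open>K\<close> created by marking \<open>M\<close> satisfies
  \<open>\<ell>(K) \<le> \<ell>(M) + 1\<close> and \<open>dist(K, M) \<le> 8 N D 2\<^bsup>-\<ell>(K)\<^esup>\<close>. For a set of
  marked simplices this persists because the closure steps of one marked simplex can be replayed on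
  every admissible refinement.
  A simplex of level \<open>\<ell>\<close> arises from its initial ancestor by at most \<open>n \<ell>\<close> bisections, each of which
  halves the volume, so only \<open>O(N\<^sup>n)\<close> simplices of level \<open>\<ell>\<close> of a triangulation lie within distance
  \<open>O(N D 2\<^bsup>-\<ell>\<^esup>)\<close> of a given point.
  Every marked \<open>M\<close> charges \<open>2\<^bsup>\<ell>(T) - \<ell>(M)\<^esup>\<close> to each nearby \<open>T\<close> with \<open>\<ell>(T) \<le> \<ell>(M) + 1\<close>: in total this is
  \<open>O(N\<^sup>n)\<close> per marked simplex, whereas every new \<open>T\<close> receives at least 1.
\<close>

section \<open>Generations and the bisection edge\<close>

text \<open>The result of Refine for a set of marked simplices is only characterized, as a coarsest
  element of \<open>BB\<close>, so what it creates cannot be read off from a computation. Instead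
  some common refinement is built by replaying the closures one after another, recording that every
  node with a descendant in the new mesh either had one before or is reached from a marked simplex.
  Coarseness transfers this to the actual mesh, whose simplices have descendants in the constructed
  one; this is why the replay lemmas speak of ancestors and not only of the new simplices. The
  exponent n of N comes from distances alone: diameters along a recursion form a geometric series of
  ratio 2^(-1/N), which costs one factor N in the radius of a ball and N^n in its volume. The charge
  2^(l(T) - l(M)) is the ratio of the mesh sizes of M and T. It also measures, in units proportional
  to the mesh size of T, how far the next link of a chain of marked simplices can lead, so a chain
  that leaves the vicinity of T has already paid 1.\<close>

lemma lev_vtype: "N > 0 \<Longrightarrow> g = int N * (lev N g - 1) + vtype N g"
  unfolding lev_def vtype_def by (simp add: algebra_simps)

lemma vtype_bounds:
  assumes "N > 0" shows "1 \<le> vtype N g" "vtype N g \<le> int N"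
  using assms pos_mod_bound[of "int N" "g - 1"] pos_mod_sign[of "int N" "g - 1"]
  unfolding vtype_def by linarith+

lemma lev_mono: "N > 0 \<Longrightarrow> p \<le> q \<Longrightarrow> lev N p \<le> lev N q"
  unfolding lev_def by (simp add: zdiv_mono1)

lemma lev_eqI:
  assumes "N > 0" "int N * (l - 1) < g" "g \<le> int N * l"
  shows "lev N g = l"
proof -
  have "(g - 1) div int N = l - 1"
    using int_div_pos_eq[of "g - 1" "int N" "l - 1" "g - 1 - int N * (l - 1)"] assms
    by (simp add: algebra_simps)
  then show ?thesis unfolding lev_def by simp
qed

text \<open>The rule separates its cases by the levels of the two lowest vertices. On the selected
  edge this amounts to comparing the levels of the endpoints, so the new generation is a function of
  their generations \<open>p\<close> and \<open>q\<close>. It then makes sense for every edge of a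
  simplex, and edges can be ranked by it.\<close>

definition mid_gen :: "nat \<Rightarrow> int \<Rightarrow> int \<Rightarrow> int" where
  "mid_gen N p q = (if lev N p \<noteq> lev N q then p + int N else q + 2 * int N + 1 - vtype N p)"

lemma mid_gen_gt:
  assumes "N > 0" "q < p" shows "p < mid_gen N p q"
proof (cases "lev N p = lev N q")
  case True
  then show ?thesis
    using lev_vtype[OF assms(1), of p] lev_vtype[OF assms(1), of q] vtype_bounds[OF assms(1), of p]
      vtype_bounds[OF assms(1), of q]
    by (simp add: mid_gen_def)
qed (use assms in \<open>simp add: mid_gen_def\<close>)

text \<open>For endpoints of equal level l the value is N(l+1) + 1 - (t(p) - t(q)) with 0 < t(p) -
  t(q) < N, which lies in the block of level l+1. For different levels it is \<open>p\<close>
  shifted by one full block.\<close>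

lemma lev_mid_gen:
  assumes "N > 0" "q < p" shows "lev N (mid_gen N p q) = lev N p + 1"
proof (cases "lev N p = lev N q")
  case True
  then show ?thesis
    using lev_vtype[OF assms(1), of p] lev_vtype[OF assms(1), of q] vtype_bounds[OF assms(1), of p]
      vtype_bounds[OF assms(1), of q] assms
    by (intro lev_eqI) (auto simp: mid_gen_def algebra_simps)
next
  case False
  then show ?thesis
    using lev_vtype[OF assms(1), of p] vtype_bounds[OF assms(1), of p] assms
    by (intro lev_eqI) (auto simp: mid_gen_def algebra_simps)
qed

lemma lev_less_imp:
  assumes "N > 0" "lev N q < lev N p"
  shows "int N * lev N q + vtype N p \<le> p"
proof -
  have "int N * lev N q \<le> int N * (lev N p - 1)"
    using assms by (intro mult_left_mono) auto
  then show ?thesis using lev_vtype[OF assms(1), of p] by linarith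
qed

section \<open>The vertices in descending order of generation\<close>

lemma vk_props:
  assumes "finite S" "inj_on snd S" "k < card S"
  shows "vk S k \<in> S" "snd (vk S k) = gens_desc S ! k"
proof -
  have len: "length (gens_desc S) = card S" using assms by (simp add: gens_desc_def card_image)
  have "gens_desc S ! k \<in> set (gens_desc S)" using assms len by (intro nth_mem) auto
  then obtain v where "v \<in> S" "snd v = gens_desc S ! k"
    using assms by (auto simp: gens_desc_def)
  then have "\<exists>!v. v \<in> S \<and> snd v = gens_desc S ! k" using assms(2) by (metis inj_onD)
  from theI'[OF this] show "vk S k \<in> S" "snd (vk S k) = gens_desc S ! k" by (auto simp: vk_def)
qed

lemma gens_desc_antimono:
  assumes "finite S" "inj_on snd S" "i < j" "j < card S"
  shows "gens_desc S ! j < gens_desc S ! i"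
proof -
  let ?xs = "sorted_list_of_set (snd ` S)"
  have len: "length ?xs = card S" using assms by (simp add: card_image)
  have "?xs ! (length ?xs - Suc j) < ?xs ! (length ?xs - Suc i)"
    using assms len by (intro sorted_wrt_nth_less[OF strict_sorted_list_of_set]) auto
  then show ?thesis using assms len by (simp add: gens_desc_def rev_nth)
qed

lemma in_gens_desc:
  assumes "finite S" "inj_on snd S" "x \<in> S"
  obtains k where "k < card S" "x = vk S k"
proof -
  have "snd x \<in> set (gens_desc S)" using assms by (simp add: gens_desc_def)
  then obtain k where k: "k < length (gens_desc S)" "gens_desc S ! k = snd x"
    by (auto simp: in_set_conv_nth)
  have len: "length (gens_desc S) = card S" using assms by (simp add: gens_desc_def card_image)
  have "x = vk S k" using vk_props[OF assms(1,2), of k] k len assms by (auto dest: inj_onD)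
  then show ?thesis using that k len by simp
qed

text \<open>The endpoints of the bisection edge, described without the enumeration of the vertices.\<close>
definition low_edge :: "nat \<Rightarrow> 'a splx \<Rightarrow> 'a vtx \<Rightarrow> 'a vtx \<Rightarrow> bool" where
  "low_edge N S a b \<longleftrightarrow> a \<in> S \<and> b \<in> S \<and> snd b < snd a \<and> (\<forall>x\<in>S. snd b \<le> snd x) \<and>
     (\<forall>x\<in>S. x \<noteq> b \<longrightarrow> lev N (snd a) \<le> lev N (snd x)) \<and>
     (if lev N (snd a) = lev N (snd b) then \<forall>x\<in>S. lev N (snd x) = lev N (snd b) \<longrightarrow> snd x \<le> snd a
      else \<forall>x\<in>S. x \<noteq> b \<longrightarrow> snd a \<le> snd x)"

text \<open>The enumeration of the vertices is used here for the last time. If the two lowest levels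
  agree, every vertex except \<open>b\<close> has at least the level of the second lowest one, which
  is that of \<open>a\<close>; hence the level clause of \<open>low_edge\<close> holds in both
  cases.\<close>

lemma bisec_data_edge:
  assumes "N > 0" "finite S" "inj_on snd S" "card S \<ge> 2"
  obtains a b where "bisec_data N S = (a, b, mid_gen N (snd a) (snd b))" "low_edge N S a b"
proof -
  define m where "m = card S - 1"
  have m: "m \<ge> 1" "m < card S" "card S = Suc m" using assms by (auto simp: m_def)
  note vk = vk_props[OF assms(2,3)] and anti = gens_desc_antimono[OF assms(2,3)]
  have anti': "snd (vk S j) < snd (vk S i)" if "i < j" "j \<le> m" for i j
    using anti[OF that(1)] vk[of i] vk[of j] that m by auto
  have b: "vk S m \<in> S" using vk m by auto
  have min: "snd (vk S m) \<le> snd x" if x: "x \<in> S" for x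
  proof -
    obtain k where "k < card S" "x = vk S k" using in_gens_desc[OF assms(2,3) x] .
    then show ?thesis using anti'[of k m] m by (cases "k = m") auto
  qed
  have min1: "snd (vk S (m - 1)) \<le> snd x" if x: "x \<in> S" "x \<noteq> vk S m" for x
  proof -
    obtain k where "k < card S" "x = vk S k" using in_gens_desc[OF assms(2,3) x(1)] .
    then show ?thesis using anti'[of k "m - 1"] m x by (cases "k < m - 1"; cases "k = m - 1"; cases "k = m") auto
  qed
  show ?thesis
  proof (cases "lev N (snd (vk S m)) = lev N (snd (vk S (m - 1)))")
    case False
    have "bisec_data N S = (vk S (m - 1), vk S m, mid_gen N (snd (vk S (m - 1))) (snd (vk S m)))"
      using False by (simp add: bisec_data_def Let_def m(3) mid_gen_def)
    moreover have "vk S (m - 1) \<in> S" "snd (vk S m) < snd (vk S (m - 1))"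
      using vk m anti'[of "m - 1" m] by auto
    moreover have "low_edge N S (vk S (m - 1)) (vk S m)"
      using calculation(2,3) b min min1 lev_mono[OF assms(1)] False by (auto simp: low_edge_def)
    ultimately show ?thesis using that by blast
  next
    case True
    define j where "j = (LEAST k. lev N (snd (vk S k)) = lev N (snd (vk S m)))"
    have jm: "j \<le> m - 1" unfolding j_def using True by (intro Least_le) auto
    have jl: "lev N (snd (vk S j)) = lev N (snd (vk S m))"
      unfolding j_def by (rule LeastI[of _ m]) simp
    have bd: "bisec_data N S = (vk S j, vk S m, mid_gen N (snd (vk S j)) (snd (vk S m)))"
    proof -
      have "bisec_data N S = (vk S j, vk S m, snd (vk S m) + 2 * int N + 1 - vtype N (snd (vk S j)))"
        using True by (simp add: bisec_data_def Let_def m(3) j_def)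
      then show ?thesis using jl by (simp add: mid_gen_def)
    qed
    have "vk S j \<in> S" "snd (vk S m) < snd (vk S j)"
      using vk m jm anti'[of j m] by auto
    moreover have "snd x \<le> snd (vk S j)" if x: "x \<in> S" "lev N (snd x) = lev N (snd (vk S m))" for x
    proof -
      obtain k where k: "k < card S" "x = vk S k" using in_gens_desc[OF assms(2,3) x(1)] .
      have "j \<le> k" unfolding j_def using x k by (intro Least_le) auto
      then show ?thesis using anti'[of j k] k m by (cases "k = j") auto
    qed
    moreover have "lev N (snd (vk S j)) \<le> lev N (snd x)" if "x \<in> S" "x \<noteq> vk S m" for x
      using lev_mono[OF assms(1) min1[OF that]] jl True by simp
    ultimately have "low_edge N S (vk S j) (vk S m)"
      using b min jl by (auto simp: low_edge_def)
    then show ?thesis using that bd by blast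
  qed
qed

definition bgen :: "nat \<Rightarrow> ('a::real_vector) splx \<Rightarrow> int" where
  "bgen N S = snd (bsv N S)"

text \<open>If \<open>b\<close> is alone on its level, an edge at \<open>b\<close> gives x + N with
  x above \<open>a\<close>, and an edge avoiding \<open>b\<close> has both endpoints at or above
  \<open>a\<close>. Otherwise let l be the common level of \<open>a\<close> and \<open>b\<close>. An
  edge with a vertex above level l gives a value beyond N(l+1), whereas \<open>a\<close>,
  \<open>b\<close> stay at or below it. Within level l the value y + 2N + 1 - t(x) increases in y
  and decreases in x, so the lowest y and the highest x win.\<close>

lemma mid_gen_minimal:
  assumes "N > 0" and le: "low_edge N S a b"
    and inj: "inj_on snd S"
    and xy: "x \<in> S" "y \<in> S" "snd y < snd x" "(x, y) \<noteq> (a, b)"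
  shows "mid_gen N (snd a) (snd b) < mid_gen N (snd x) (snd y)"
proof -
  have ab: "a \<in> S" "b \<in> S" "snd b < snd a"
    and bmin: "\<And>x. x \<in> S \<Longrightarrow> snd b \<le> snd x"
    and la: "\<And>x. x \<in> S \<Longrightarrow> x \<noteq> b \<Longrightarrow> lev N (snd a) \<le> lev N (snd x)"
    and c: "\<And>x. x \<in> S \<Longrightarrow> x \<noteq> b \<Longrightarrow> lev N (snd a) \<noteq> lev N (snd b) \<Longrightarrow> snd a \<le> snd x"
    and d: "\<And>x. x \<in> S \<Longrightarrow> lev N (snd a) = lev N (snd b) \<Longrightarrow> lev N (snd x) = lev N (snd b)
        \<Longrightarrow> snd x \<le> snd a"
    using le by (auto simp: low_edge_def split: if_splits)
  note lv = lev_vtype[OF assms(1)] and vb = vtype_bounds[OF assms(1)]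
    and ll = lev_less_imp[OF assms(1)]
  have xb: "x \<noteq> b" using bmin[OF xy(2)] xy(3) by auto
  show ?thesis
  proof (cases "lev N (snd a) = lev N (snd b)")
    case False
    have ax: "snd a \<le> snd x" using c[OF xy(1) xb False] .
    show ?thesis
    proof (cases "y = b")
      case True
      with xy inj ab(1) have "snd x \<noteq> snd a" by (auto dest: inj_onD)
      with ax have lt: "snd a < snd x" by simp
      have "lev N (snd x) \<noteq> lev N (snd y)"
        using lev_mono[OF assms(1), of "snd a" "snd x"] lt False True
          lev_mono[OF assms(1), of "snd b" "snd a"] ab(3) by auto
      then show ?thesis using lt False by (simp add: mid_gen_def)
    next
      case False2: False
      have ay: "snd a \<le> snd y" using c[OF xy(2) False2 False] .
      show ?thesis using False ay xy(3) vb[of "snd x"] by (auto simp: mid_gen_def)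
    qed
  next
    case True
    note lab = lv[of "snd a"] lv[of "snd b"] vb[of "snd a"] vb[of "snd b"]
    have m: "mid_gen N (snd a) (snd b) = snd b + 2 * int N + 1 - vtype N (snd a)"
      using True by (simp add: mid_gen_def)
    have vab: "vtype N (snd b) < vtype N (snd a)" using lab True ab(3) by simp
    have lb: "lev N (snd b) \<le> lev N (snd y)" "lev N (snd b) \<le> lev N (snd x)"
      using lev_mono[OF assms(1)] bmin xy by auto
    show ?thesis
    proof (cases "lev N (snd x) = lev N (snd y)")
      case False
      have "lev N (snd y) \<le> lev N (snd x)" using xy lev_mono[OF assms(1)] by simp
      then have "int N * lev N (snd b) + vtype N (snd x) \<le> snd x"
        using ll[of "snd b" "snd x"] False lb by linarith
      then show ?thesis using m False vab lab True vb[of "snd x"]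
        by (simp add: mid_gen_def algebra_simps)
    next
      case eq: True
      have M: "mid_gen N (snd x) (snd y) = snd y + 2 * int N + 1 - vtype N (snd x)"
        using eq by (simp add: mid_gen_def)
      show ?thesis
      proof (cases "lev N (snd y) = lev N (snd b)")
        case False
        then have "int N * lev N (snd b) + vtype N (snd y) \<le> snd y" using ll lb by simp
        then show ?thesis using M m lab vab True vb[of "snd x"] vb[of "snd y"]
          by (simp add: algebra_simps)
      next
        case yb: True
        have xa: "snd x \<le> snd a" using d[OF xy(1) True] eq yb by simp
        have vx: "vtype N (snd x) \<le> vtype N (snd a)"
          using xa lv[of "snd x"] lab eq yb True by simp
        have "snd b < snd y \<or> vtype N (snd x) < vtype N (snd a)"
        proof (cases "y = b")
          case yb': True
          then have "snd x \<noteq> snd a" using inj xy ab(1) by (auto dest: inj_onD)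
          then have "snd x < snd a" using xa by simp
          then show ?thesis using lv[of "snd x"] lab eq yb True by simp
        next
          case False
          then have "snd y \<noteq> snd b" using inj xy ab(2) by (auto dest: inj_onD)
          then show ?thesis using bmin[OF xy(2)] by simp
        qed
        then show ?thesis using M m vx bmin[OF xy(2)] by auto
      qed
    qed
  qed
qed

section \<open>Halving a simplex\<close>

lemma bary_unique:
  fixes u v :: "'a::real_vector \<Rightarrow> real"
  assumes "finite P" "\<not> affine_dependent P" "sum u P = sum v P"
    "(\<Sum>p\<in>P. u p *\<^sub>R p) = (\<Sum>p\<in>P. v p *\<^sub>R p)" "p \<in> P"
  shows "u p = v p"
proof (rule ccontr)
  assume "u p \<noteq> v p"
  then have "affine_dependent P" unfolding affine_dependent_explicit_finite[OF assms(1)]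
    using assms by (intro exI[of _ "\<lambda>x. u x - v x"])
      (auto simp: sum_subtractf scaleR_diff_left)
  then show False using assms by simp
qed

lemma hull_subset_bary:
  fixes P :: "'a::real_vector set"
  assumes "finite P" "Q \<subseteq> P"
  shows "x \<in> convex hull Q \<longleftrightarrow> (\<exists>u. (\<forall>p\<in>P. 0 \<le> u p) \<and> (\<forall>p\<in>P - Q. u p = 0) \<and> sum u P = 1 \<and>
            (\<Sum>p\<in>P. u p *\<^sub>R p) = x)" (is "_ \<longleftrightarrow> (\<exists>u. ?R u)")
proof
  have fQ: "finite Q" using assms finite_subset by blast
  assume "x \<in> convex hull Q"
  then obtain u where u: "\<forall>p\<in>Q. 0 \<le> u p" "sum u Q = 1" "(\<Sum>p\<in>Q. u p *\<^sub>R p) = x"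
    unfolding convex_hull_finite[OF fQ] by auto
  define v where "v p = (if p \<in> Q then u p else 0)" for p
  have "sum v P = sum u Q"
    by (rule sum.mono_neutral_cong_right) (use assms in \<open>auto simp: v_def\<close>)
  moreover have "(\<Sum>p\<in>P. v p *\<^sub>R p) = (\<Sum>p\<in>Q. u p *\<^sub>R p)"
    by (rule sum.mono_neutral_cong_right) (use assms in \<open>auto simp: v_def\<close>)
  ultimately show "\<exists>u. ?R u" using u by (intro exI[of _ v]) (auto simp: v_def)
next
  have fQ: "finite Q" using assms finite_subset by blast
  assume "\<exists>u. ?R u"
  then obtain u where u: "?R u" by blast
  have "sum u Q = sum u P"
    by (rule sum.mono_neutral_left) (use assms u in auto)
  moreover have "(\<Sum>p\<in>Q. u p *\<^sub>R p) = (\<Sum>p\<in>P. u p *\<^sub>R p)"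
    by (rule sum.mono_neutral_left) (use assms u in auto)
  ultimately show "x \<in> convex hull Q"
    unfolding convex_hull_finite[OF fQ] using u assms by auto
qed

abbreviation mid :: "'a::real_vector \<Rightarrow> 'a \<Rightarrow> 'a" where
  "mid a b \<equiv> (1/2) *\<^sub>R (a + b)"

lemma mid_notin:
  fixes P :: "'a::real_vector set"
  assumes "finite P" "\<not> affine_dependent P" "a \<in> P" "b \<in> P" "a \<noteq> b"
  shows "mid a b \<notin> affine hull (P - {a})"
proof
  assume "mid a b \<in> affine hull (P - {a})"
  moreover have "b \<in> affine hull (P - {a})" using assms by (simp add: hull_inc)
  ultimately have "2 *\<^sub>R mid a b + (-1) *\<^sub>R b \<in> affine hull (P - {a})"
    by (intro mem_affine[OF affine_affine_hull]) auto
  then have "a \<in> affine hull (P - {a})" by simp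
  then show False using assms by (auto simp: affine_dependent_def)
qed

lemma mid_notin_set:
  fixes P :: "'a::real_vector set"
  assumes "finite P" "\<not> affine_dependent P" "a \<in> P" "b \<in> P" "a \<noteq> b"
  shows "mid a b \<notin> P"
proof
  assume "mid a b \<in> P"
  then have "mid a b = a" using mid_notin[OF assms] hull_inc[of "mid a b" "P - {a}" affine] by blast
  then have "2 *\<^sub>R mid a b = 2 *\<^sub>R a" by (rule arg_cong)
  then show False using assms(5) by (simp add: scaleR_2)
qed

lemma affine_independent_half:
  fixes P :: "'a::euclidean_space set"
  assumes "finite P" "\<not> affine_dependent P" "a \<in> P" "b \<in> P" "a \<noteq> b"
  shows "\<not> affine_dependent (insert (mid a b) (P - {a}))"
  using affine_independent_insert[OF affine_independent_Diff[OF assms(2)] mid_notin[OF assms]] by auto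

text \<open>In barycentric coordinates the half that keeps \<open>b\<close> is cut out by
  \<open>u a \<le> u b\<close>. A weight on the midpoint counts half at \<open>a\<close> and half at
  \<open>b\<close>; conversely, \<open>2 * u a\<close> can be moved to the midpoint, leaving
  \<open>u b - u a\<close> at \<open>b\<close>.\<close>

lemma hull_half:
  fixes P :: "'a::real_vector set"
  assumes "finite P" "a \<in> P" "b \<in> P" "a \<noteq> b" "mid a b \<notin> P"
  shows "x \<in> convex hull (insert (mid a b) (P - {a})) \<longleftrightarrow>
    (\<exists>u. (\<forall>p\<in>P. 0 \<le> u p) \<and> sum u P = 1 \<and> (\<Sum>p\<in>P. u p *\<^sub>R p) = x \<and> u a \<le> u b)"
    (is "_ \<longleftrightarrow> (\<exists>u. ?R u)")
proof -
  let ?Q = "P - {a} - {b}" and ?w = "mid a b"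
  have fin: "finite (insert ?w (P - {a}))" using assms by simp
  have sP: "sum f P = f a + f b + sum f ?Q" for f :: "'a \<Rightarrow> 'b::ab_group_add"
    using assms by (simp add: sum.remove[of P a] sum.remove[of "P - {a}" b] add.assoc)
  have sH: "sum f (insert ?w (P - {a})) = f ?w + f b + sum f ?Q" for f :: "'a \<Rightarrow> 'b::ab_group_add"
    using assms by (simp add: sum.remove[of "P - {a}" b] add.assoc)
  show ?thesis
  proof
    assume "x \<in> convex hull (insert ?w (P - {a}))"
    then obtain v where v: "\<forall>p\<in>insert ?w (P - {a}). 0 \<le> v p" "sum v (insert ?w (P - {a})) = 1"
      "(\<Sum>p\<in>insert ?w (P - {a}). v p *\<^sub>R p) = x"
      unfolding convex_hull_finite[OF fin] by auto
    define u where "u p = (if p = a then v ?w / 2 else if p = b then v b + v ?w / 2 else v p)" for p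
    have u1: "sum u ?Q = sum v ?Q" and u2: "(\<Sum>p\<in>?Q. u p *\<^sub>R p) = (\<Sum>p\<in>?Q. v p *\<^sub>R p)"
      by (auto intro!: sum.cong simp: u_def)
    have ua: "u a = v ?w / 2" and ub: "u b = v b + v ?w / 2" using assms by (auto simp: u_def)
    have e: "(v ?w / 2) *\<^sub>R a + (v b + v ?w / 2) *\<^sub>R b = v ?w *\<^sub>R ?w + v b *\<^sub>R b"
      by (simp add: scaleR_add_right scaleR_add_left)
    have "sum u P = 1" unfolding sP u1 ua ub using v(2) unfolding sH by simp
    moreover have "(\<Sum>p\<in>P. u p *\<^sub>R p) = x" unfolding sP u2 ua ub e using v(3) unfolding sH .
    moreover have "\<forall>p\<in>P. 0 \<le> u p" "u a \<le> u b" using v(1) assms by (auto simp: u_def)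
    ultimately have "?R u" by blast
    then show "\<exists>u. ?R u" by blast
  next
    assume "\<exists>u. ?R u"
    then obtain u where u: "?R u" by blast
    define v where "v p = (if p = ?w then 2 * u a else if p = b then u b - u a else u p)" for p
    have vQ: "v p = u p" if "p \<in> ?Q" for p using that assms by (auto simp: v_def)
    have v1: "sum v ?Q = sum u ?Q" and v2: "(\<Sum>p\<in>?Q. v p *\<^sub>R p) = (\<Sum>p\<in>?Q. u p *\<^sub>R p)"
      using vQ by simp_all
    have "?w \<noteq> b" using assms by auto
    then have vw: "v ?w = 2 * u a" and vb: "v b = u b - u a" by (auto simp: v_def)
    have e: "(2 * u a) *\<^sub>R ?w + (u b - u a) *\<^sub>R b = u a *\<^sub>R a + u b *\<^sub>R b"
      by (simp add: scaleR_add_right scaleR_diff_left)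
    have "sum v (insert ?w (P - {a})) = 1" unfolding sH v1 vw vb using u unfolding sP by simp
    moreover have "(\<Sum>p\<in>insert ?w (P - {a}). v p *\<^sub>R p) = x"
      unfolding sH v2 vw vb e using u unfolding sP by blast
    moreover have "\<forall>p\<in>insert ?w (P - {a}). 0 \<le> v p" using u assms by (auto simp: v_def)
    ultimately show "x \<in> convex hull (insert ?w (P - {a}))"
      unfolding convex_hull_finite[OF fin] by blast
  qed
qed

lemma hull_half_Un:
  fixes P :: "'a::real_vector set"
  assumes "finite P" "a \<in> P" "b \<in> P" "a \<noteq> b" "mid a b \<notin> P"
  shows "convex hull P = convex hull (insert (mid a b) (P - {a})) \<union> convex hull (insert (mid a b) (P - {b}))"
    (is "_ = ?A \<union> ?B")
proof -
  have B: "x \<in> ?B \<longleftrightarrow> (\<exists>u. (\<forall>p\<in>P. 0 \<le> u p) \<and> sum u P = 1 \<and> (\<Sum>p\<in>P. u p *\<^sub>R p) = x \<and> u b \<le> u a)" for x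
    using hull_half[of P b a x] assms by (simp add: add.commute)
  have P: "x \<in> convex hull P \<longleftrightarrow> (\<exists>u. (\<forall>p\<in>P. 0 \<le> u p) \<and> sum u P = 1 \<and> (\<Sum>p\<in>P. u p *\<^sub>R p) = x)" for x
    using hull_subset_bary[OF assms(1) subset_refl, of x] by simp
  show ?thesis
    unfolding set_eq_iff Un_iff B hull_half[OF assms] P
  proof (intro allI iffI; elim disjE exE conjE)
    fix x u assume "\<forall>p\<in>P. 0 \<le> u p" "sum u P = 1" "(\<Sum>p\<in>P. u p *\<^sub>R p) = x"
    then show "(\<exists>u. (\<forall>p\<in>P. 0 \<le> u p) \<and> sum u P = 1 \<and> (\<Sum>p\<in>P. u p *\<^sub>R p) = x \<and> u a \<le> u b) \<or>
      (\<exists>u. (\<forall>p\<in>P. 0 \<le> u p) \<and> sum u P = 1 \<and> (\<Sum>p\<in>P. u p *\<^sub>R p) = x \<and> u b \<le> u a)"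
      by (cases "u a \<le> u b") (blast intro: less_imp_le, metis linear)
  qed blast+
qed

text \<open>Coordinates are unique, so a point of the face \<open>I\<close> in the half has
  \<open>u a \<le> u b\<close> and \<open>u\<close> vanishing off \<open>I\<close>. If the face
  misses an endpoint, this forces \<open>u a = 0\<close>. If it contains the edge, it is halved
  itself, and the two halves meet where \<open>u a = u b\<close>, that is, in the face spanned by
  the midpoint and the remaining vertices.\<close>

lemma hull_Int_half:
  fixes P :: "'a::real_vector set"
  assumes "finite P" "\<not> affine_dependent P" "a \<in> P" "b \<in> P" "a \<noteq> b" "I \<subseteq> P"
    and x: "x \<in> convex hull I" "x \<in> convex hull (insert (mid a b) (P - {a}))"
  shows "\<not> (a \<in> I \<and> b \<in> I) \<Longrightarrow> x \<in> convex hull (I - {a})"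
    and "a \<in> I \<Longrightarrow> b \<in> I \<Longrightarrow> x \<in> convex hull (insert (mid a b) (I - {a}))"
    and "a \<in> I \<Longrightarrow> b \<in> I \<Longrightarrow> x \<in> convex hull (insert (mid a b) (P - {b})) \<Longrightarrow>
           x \<in> convex hull (insert (mid a b) (I - {a,b}))"
proof -
  have w: "mid a b \<notin> P" using mid_notin_set assms by blast
  have fI: "finite I" using assms finite_subset by blast
  obtain u where u: "\<forall>p\<in>P. 0 \<le> u p" "\<forall>p\<in>P - I. u p = 0" "sum u P = 1" "(\<Sum>p\<in>P. u p *\<^sub>R p) = x"
    using x(1) unfolding hull_subset_bary[OF assms(1,6)] by blast
  obtain v where v: "sum v P = 1" "(\<Sum>p\<in>P. v p *\<^sub>R p) = x" "v a \<le> v b"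
    using x(2) unfolding hull_half[OF assms(1,3,4,5) w] by blast
  have uv: "u p = v p" if "p \<in> P" for p
    using bary_unique[OF assms(1,2) _ _ that] u v by auto
  have ab: "u a \<le> u b" using uv v assms by simp
  show "x \<in> convex hull (I - {a})" if nab: "\<not> (a \<in> I \<and> b \<in> I)"
  proof -
    have "u a = 0 \<or> u b = 0" using nab u(2) assms(3,4) by blast
    moreover have "0 \<le> u a" using u(1) assms(3) by blast
    ultimately have "u a = 0" using ab by linarith
    then have "\<forall>p\<in>P - (I - {a}). u p = 0" using u(2) by blast
    moreover have "I - {a} \<subseteq> P" using assms by auto
    ultimately show ?thesis unfolding hull_subset_bary[OF assms(1) \<open>I - {a} \<subseteq> P\<close>] using u
      by blast
  qed
  assume abI: "a \<in> I" "b \<in> I"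
  have wI: "mid a b \<notin> I" using w assms by auto
  have uI: "sum u I = 1" "(\<Sum>p\<in>I. u p *\<^sub>R p) = x" "\<forall>p\<in>I. 0 \<le> u p"
    using u sum.mono_neutral_left[OF assms(1,6), of u]
      sum.mono_neutral_left[OF assms(1,6), of "\<lambda>p. u p *\<^sub>R p"] assms(6)
    by auto
  show h: "x \<in> convex hull (insert (mid a b) (I - {a}))"
    unfolding hull_half[OF fI abI assms(5) wI] using uI ab by blast
  assume xb: "x \<in> convex hull (insert (mid a b) (P - {b}))"
  obtain v' where v': "sum v' P = 1" "(\<Sum>p\<in>P. v' p *\<^sub>R p) = x" "v' b \<le> v' a"
    using xb hull_half[of P b a x] assms w by (auto simp: add.commute)
  have "u p = v' p" if "p \<in> P" for p
    using bary_unique[OF assms(1,2) _ _ that] u v' by auto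
  then have eq: "u a = u b" using ab v' assms by simp
  define t where "t p = (if p = mid a b then 2 * u a else u p)" for p
  let ?J = "insert (mid a b) (I - {a,b})"
  have fJ: "finite ?J" using fI by simp
  have sI: "sum f I = f a + f b + sum f (I - {a,b})" for f :: "'a \<Rightarrow> 'b::ab_group_add"
    using fI abI assms(5) sum.remove[of I a f] sum.remove[of "I - {a}" b f]
    by (simp add: add.assoc Diff_insert2[symmetric])
  have sJ: "sum f ?J = f (mid a b) + sum f (I - {a,b})" for f :: "'a \<Rightarrow> 'b::ab_group_add"
    using fI wI by simp
  have tI: "t p = u p" if "p \<in> I" for p using that wI by (auto simp: t_def)
  have "sum t (I - {a,b}) = sum u (I - {a,b})" "(\<Sum>p\<in>I - {a,b}. t p *\<^sub>R p) = (\<Sum>p\<in>I - {a,b}. u p *\<^sub>R p)"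
    using tI by simp_all
  moreover have "sum u (I - {a,b}) = 1 - 2 * u a" "(\<Sum>p\<in>I - {a,b}. u p *\<^sub>R p) = x - u a *\<^sub>R (a + b)"
    using uI eq unfolding sI by (auto simp: algebra_simps)
  ultimately show "x \<in> convex hull (insert (mid a b) (I - {a,b}))"
  proof -
    assume t: "sum t (I - {a,b}) = sum u (I - {a,b})"
      "(\<Sum>p\<in>I - {a,b}. t p *\<^sub>R p) = (\<Sum>p\<in>I - {a,b}. u p *\<^sub>R p)"
      and u1: "sum u (I - {a,b}) = 1 - 2 * u a"
      "(\<Sum>p\<in>I - {a,b}. u p *\<^sub>R p) = x - u a *\<^sub>R (a + b)"
    have tw: "t (mid a b) = 2 * u a" by (simp add: t_def)
    have "sum t ?J = 1" "(\<Sum>p\<in>?J. t p *\<^sub>R p) = x"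
      unfolding sJ t tw u1 by simp_all
    moreover have "\<forall>p\<in>?J. 0 \<le> t p" using uI abI by (auto simp: t_def)
    ultimately show ?thesis unfolding convex_hull_finite[OF fJ] by blast
  qed
qed

lemma vertex_in_hull:
  fixes P :: "'a::euclidean_space set"
  assumes "\<not> affine_dependent P" "Q \<subseteq> P" "p \<in> P" "p \<in> convex hull Q"
  shows "p \<in> Q"
proof (rule ccontr)
  assume "p \<notin> Q"
  then have "p \<in> affine hull (P - {p})"
    using assms convex_hull_subset_affine_hull[of Q] hull_mono[of Q "P - {p}" affine] by blast
  then show False using assms by (auto simp: affine_dependent_def)
qed

lemma removed_vertex_notin_half:
  fixes P :: "'a::euclidean_space set"
  assumes "finite P" "\<not> affine_dependent P" "a \<in> P" "b \<in> P" "a \<noteq> b"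
  shows "a \<notin> convex hull (insert (mid a b) (P - {a}))"
proof
  assume "a \<in> convex hull (insert (mid a b) (P - {a}))"
  then have "a \<in> convex hull ({a} - {a})"
    using hull_Int_half(1)[OF assms, of "{a}" a] assms by auto
  then show False by simp
qed

section \<open>Equal volume of the two halves\<close>

lemma nn_integral_lborel_translate:
  fixes h :: "'a::euclidean_space \<Rightarrow> ennreal"
  assumes [measurable]: "h \<in> borel_measurable borel"
  shows "(\<integral>\<^sup>+x. h (c + x) \<partial>lborel) = (\<integral>\<^sup>+x. h x \<partial>lborel)"
proof -
  have "(\<integral>\<^sup>+x. h x \<partial>lborel) = (\<integral>\<^sup>+x. h x \<partial>distr lborel borel ((+) c))" by (simp add: lborel_distr_plus)
  also have "\<dots> = (\<integral>\<^sup>+x. h (c + x) \<partial>lborel)" by (subst nn_integral_distr) auto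
  finally show ?thesis by simp
qed

text \<open>Uniqueness of Haar measure: the push-forward of Lebesgue measure under \<open>f\<close> is translation
  invariant, hence a multiple of Lebesgue measure, and the factor squares to 1.\<close>
lemma emeasure_linear_involution:
  fixes f :: "'a::euclidean_space \<Rightarrow> 'a"
  assumes f: "linear f" "\<And>x. f (f x) = x" and [measurable]: "A \<in> sets borel"
  shows "emeasure lborel (f -` A) = emeasure lborel A"
proof -
  have [measurable]: "f \<in> borel_measurable borel"
    using f(1) by (intro borel_measurable_continuous_onI linear_continuous_on linear_conv_bounded_linear[THEN iffD1])
  let ?B = "ball 0 1 :: 'a set"
  have [measurable]: "?B \<in> sets borel" by simp
  have key: "emeasure lborel (f -` A) * emeasure lborel ?B = emeasure lborel (f -` ?B) * emeasure lborel A"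
    if [measurable]: "A \<in> sets borel" for A
  proof -
    \<comment> \<open>The double integral of \<open>?h\<close> is evaluated in both orders.
      Integrating over \<open>y\<close> gives the left side. Substituting \<open>f y + x\<close> for
      \<open>x\<close> turns \<open>f x\<close> into \<open>y + f x\<close>, since \<open>f\<close>
      is an involution, and \<open>y - f x\<close> into \<open>- f x\<close>; as the ball is
      symmetric, this gives the right side.\<close>
    let ?h = "\<lambda>x y. indicator A (f x) * indicator ?B (y - f x) :: ennreal"
    have [measurable]: "f -` A \<in> sets borel" "f -` ?B \<in> sets borel"
      using measurable_sets_borel[OF \<open>f \<in> borel_measurable borel\<close>] by auto
    have 1: "(\<integral>\<^sup>+y. indicator ?B (y - f x) \<partial>lborel) = emeasure lborel ?B" for x
      using nn_integral_lborel_translate[of "indicator ?B" "- f x", OF borel_measurable_indicator] by simp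
    have "(\<integral>\<^sup>+x. \<integral>\<^sup>+y. ?h x y \<partial>lborel \<partial>lborel) = (\<integral>\<^sup>+x. indicator A (f x) * emeasure lborel ?B \<partial>lborel)"
    proof (rule nn_integral_cong)
      fix x :: 'a
      have "(\<lambda>y. indicator ?B (y - f x) :: ennreal) = indicator (ball (f x) 1)"
        by (auto simp: indicator_def dist_norm norm_minus_commute fun_eq_iff)
      then have "(\<lambda>y. indicator ?B (y - f x) :: ennreal) \<in> borel_measurable lborel"
        by (simp only:) (rule borel_measurable_indicator, simp)
      then show "(\<integral>\<^sup>+y. ?h x y \<partial>lborel) = indicator A (f x) * emeasure lborel ?B"
        by (simp add: nn_integral_cmult 1)
    qed
    also have "\<dots> = (\<integral>\<^sup>+x. indicator (f -` A) x * emeasure lborel ?B \<partial>lborel)"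
      by (simp add: indicator_def)
    also have "\<dots> = emeasure lborel (f -` A) * emeasure lborel ?B"
      by (simp add: nn_integral_multc)
    finally have l: "(\<integral>\<^sup>+x. \<integral>\<^sup>+y. ?h x y \<partial>lborel \<partial>lborel) = emeasure lborel (f -` A) * emeasure lborel ?B" .
    have "(\<integral>\<^sup>+x. \<integral>\<^sup>+y. ?h x y \<partial>lborel \<partial>lborel) = (\<integral>\<^sup>+y. \<integral>\<^sup>+x. ?h x y \<partial>lborel \<partial>lborel)"
      by (rule lborel_pair.Fubini'[symmetric]) measurable
    also have "\<dots> = (\<integral>\<^sup>+y. \<integral>\<^sup>+x. indicator A (y + f x) * indicator ?B (f x) \<partial>lborel \<partial>lborel)"
    proof (rule nn_integral_cong)
      fix y :: 'a
      have "(\<integral>\<^sup>+x. ?h x y \<partial>lborel) = (\<integral>\<^sup>+x. ?h (f y + x) y \<partial>lborel)"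
        by (rule nn_integral_lborel_translate[symmetric]) measurable
      also have "\<dots> = (\<integral>\<^sup>+x. indicator A (y + f x) * indicator ?B (f x) \<partial>lborel)"
        by (rule nn_integral_cong) (simp add: linear_add[OF f(1)] f(2) indicator_def)
      finally show "(\<integral>\<^sup>+x. ?h x y \<partial>lborel) = (\<integral>\<^sup>+x. indicator A (y + f x) * indicator ?B (f x) \<partial>lborel)" .
    qed
    also have "\<dots> = (\<integral>\<^sup>+x. \<integral>\<^sup>+y. indicator A (y + f x) * indicator ?B (f x) \<partial>lborel \<partial>lborel)"
      by (rule lborel_pair.Fubini') measurable
    also have "\<dots> = (\<integral>\<^sup>+x. emeasure lborel A * indicator (f -` ?B) x \<partial>lborel)"
    proof (rule nn_integral_cong)
      fix x :: 'a
      have "(\<integral>\<^sup>+y. indicator A (f x + y) \<partial>lborel) = emeasure lborel A"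
        using nn_integral_lborel_translate[of "indicator A" "f x", OF borel_measurable_indicator] that by simp
      then show "(\<integral>\<^sup>+y. indicator A (y + f x) * indicator ?B (f x) \<partial>lborel) = emeasure lborel A * indicator (f -` ?B) x"
        by (simp add: nn_integral_multc add.commute indicator_def)
    qed
    also have "\<dots> = emeasure lborel (f -` ?B) * emeasure lborel A"
      by (simp add: nn_integral_cmult mult.commute)
    finally show ?thesis using l by simp
  qed
  have [measurable]: "f -` ?B \<in> sets borel"
    using measurable_sets_borel[OF \<open>f \<in> borel_measurable borel\<close>] by auto
  define s where "s = measure lborel (f -` ?B)"
  have fin: "emeasure lborel ?B < \<infinity>" "0 < measure lborel ?B"
    using emeasure_lborel_ball_finite[of 0 1] content_ball_pos[of 1 0] by auto
  have "f -` (f -` ?B) = ?B" using f(2) by auto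
  then have sq: "emeasure lborel ?B * emeasure lborel ?B = emeasure lborel (f -` ?B) * emeasure lborel (f -` ?B)"
    using key[of "f -` ?B"] by simp
  have "bounded (f ` ?B)" using f(1) by (intro bounded_linear_image) (auto simp: linear_conv_bounded_linear)
  moreover have "f -` ?B = f ` ?B" by (auto simp: f(2) image_iff intro!: bexI[of _ "f _"])
  ultimately have "emeasure lborel (f -` ?B) < \<infinity>" using emeasure_bounded_finite by metis
  then have s: "emeasure lborel (f -` ?B) = ennreal s" unfolding s_def
    by (intro emeasure_eq_ennreal_measure) auto
  have B: "emeasure lborel ?B = ennreal (measure lborel ?B)"
    by (intro emeasure_eq_ennreal_measure) (use fin in auto)
  have "(measure lborel ?B)\<^sup>2 = s\<^sup>2"
    using sq unfolding s B by (simp add: ennreal_mult[symmetric] power2_eq_square s_def)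
  then have "s = measure lborel ?B"
    using fin by (simp add: s_def power2_eq_iff_nonneg)
  then have "emeasure lborel (f -` A) * emeasure lborel ?B = emeasure lborel A * emeasure lborel ?B"
    using key[of A] s B by (simp add: mult.commute)
  then have "emeasure lborel (f -` A) * emeasure lborel ?B / emeasure lborel ?B =
      emeasure lborel A * emeasure lborel ?B / emeasure lborel ?B" by simp
  moreover have "emeasure lborel ?B \<noteq> 0" using B fin by simp
  ultimately show ?thesis using fin by (simp add: ennreal_mult_divide_eq less_top)
qed

text \<open>The two halves have equal volume since the affine involution that swaps \<open>a\<close> and \<open>b\<close>
  and fixes all other vertices exchanges them.\<close>
lemma measure_half:
  fixes P :: "'a::euclidean_space set"
  assumes "finite P" "\<not> affine_dependent P" "card P = DIM('a) + 1" "DIM('a) \<ge> 2" "a \<in> P" "b \<in> P" "a \<noteq> b"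
  shows "measure lebesgue (convex hull P) \<le> 2 * measure lebesgue (convex hull (insert (mid a b) (P - {a})))"
proof -
  let ?A = "insert (mid a b) (P - {a})" and ?B = "insert (mid a b) (P - {b})"
  \<comment> \<open>In dimension at least 2 there is a third vertex. Taken as origin, it is fixed by
    the affine swap, which thereby becomes a linear map.\<close>
  have "\<not> P \<subseteq> {a, b}"
    using assms card_mono[of "{a,b}" P] by (auto simp: card_insert_if)
  then obtain p where p: "p \<in> P" "p \<noteq> a" "p \<noteq> b" by auto
  define T where "T = (\<lambda>x. - p + x)"
  define E where "E = T ` (P - {p})"
  have ind: "independent E"
    using affine_dependent_iff_dependent2[OF p(1)] assms(2) by (simp add: E_def T_def)
  have injT: "inj T" by (simp add: T_def inj_def)
  have cE: "card E = DIM('a)" unfolding E_def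
    using p assms injT by (subst card_image) (auto simp: inj_on_def)
  have spE: "span E = UNIV"
    using card_ge_dim_independent[of E UNIV] ind cE by auto
  define \<sigma> where "\<sigma> x = (if x = T a then T b else if x = T b then T a else x)" for x
  obtain g where g: "linear g" "\<And>x. x \<in> E \<Longrightarrow> g x = \<sigma> x"
    using linear_independent_extend[OF ind, of \<sigma>] by auto
  have abE: "T a \<in> E" "T b \<in> E" using assms p by (auto simp: E_def)
  have Tab: "T a \<noteq> T b" using injT assms by (auto dest: injD)
  have ga: "g (T a) = T b" "g (T b) = T a" using g(2) abE Tab by (auto simp: \<sigma>_def)
  have "g (g x) = x" if "x \<in> E" for x
    using g(2)[OF that] ga that by (auto simp: \<sigma>_def g(2))
  then have gg: "g (g x) = x" for x
    using linear_eq_on[of "g \<circ> g" id x E] g(1) spE linear_compose[OF g(1) g(1)]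
    by (auto simp: linear_id)
  have g0: "g (T x) = T x" if "x \<in> P" "x \<noteq> a" "x \<noteq> b" for x
  proof (cases "x = p")
    case True
    then show ?thesis using linear_0[OF g(1)] by (simp add: T_def)
  next
    case False
    then have "T x \<in> E" using that by (auto simp: E_def)
    then show ?thesis using g(2) that injT by (auto simp: \<sigma>_def dest: injD)
  qed
  have Tm: "T (mid a b) = mid (T a) (T b)"
  proof -
    have "mid (T a) (T b) = - ((1/2) *\<^sub>R p + (1/2) *\<^sub>R p) + mid a b"
      by (simp add: T_def algebra_simps)
    also have "(1/2) *\<^sub>R p + (1/2) *\<^sub>R p = p" by (simp add: scaleR_add_left[symmetric])
    finally show ?thesis by (simp add: T_def)
  qed
  have gm: "g (T (mid a b)) = T (mid a b)"
    unfolding Tm using ga g(1) by (simp add: linear_add linear_cmul add.commute)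
  have im: "g ` T ` ?A = T ` ?B"
  proof -
    have "P - {a} = insert b (P - {a,b})" "P - {b} = insert a (P - {a,b})" using assms by auto
    moreover have "(\<lambda>x. g (T x)) ` (P - {a,b}) = T ` (P - {a,b})" by (intro image_cong) (auto simp: g0)
    ultimately show ?thesis by (simp add: image_image gm ga)
  qed
  have cA: "compact (convex hull ?A)" "compact (convex hull ?B)"
    using assms by (auto intro!: finite_imp_compact_convex_hull)
  have cT: "compact (convex hull (T ` ?A))" "compact (convex hull (T ` ?B))"
    using assms by (auto intro!: finite_imp_compact_convex_hull)
  have mT: "measure lebesgue (convex hull (T ` X)) = measure lebesgue (convex hull X)" for X
    unfolding T_def convex_hull_translation by (rule measure_translation)
  have "g -` (convex hull (T ` ?B)) = convex hull (T ` ?A)"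
  proof -
    have "g -` X = g ` X" for X by (auto simp: gg image_iff intro!: bexI[of _ "g _"])
    then have "g -` (convex hull (T ` ?B)) = g ` g ` (convex hull (T ` ?A))"
      by (simp only: im[symmetric] convex_hull_linear_image[OF g(1)])
    then show ?thesis by (simp add: image_image gg)
  qed
  then have "emeasure lborel (convex hull (T ` ?A)) = emeasure lborel (convex hull (T ` ?B))"
    using emeasure_linear_involution[OF g(1) gg, of "convex hull (T ` ?B)"] cT by (simp add: borel_compact)
  then have "measure lebesgue (convex hull (T ` ?A)) = measure lebesgue (convex hull (T ` ?B))"
    using cT by (simp add: measure_def borel_compact)
  then have eq: "measure lebesgue (convex hull ?A) = measure lebesgue (convex hull ?B)" by (simp only: mT)
  have "convex hull P = convex hull ?A \<union> convex hull ?B"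
    using hull_half_Un[OF assms(1,5,6,7) mid_notin_set[OF assms(1,2,5,6,7)]] .
  then have "measure lebesgue (convex hull P) \<le> measure lebesgue (convex hull ?A) + measure lebesgue (convex hull ?B)"
    using cA by (metis measure_Un_le lmeasurable_compact fmeasurableD)
  then show ?thesis using eq by simp
qed

section \<open>Bisection of labelled simplices\<close>

text \<open>The last conjunct makes the invariant inductive: a midpoint newer than all vertices
  keeps the generations of a child distinct and becomes its newest vertex.\<close>

definition good :: "nat \<Rightarrow> ('a::euclidean_space) splx \<Rightarrow> bool" where
  "good N S \<longleftrightarrow> finite S \<and> card S = DIM('a) + 1 \<and> inj_on fst S \<and> \<not> affine_dependent (fst ` S) \<and>
     inj_on snd S \<and> (\<forall>v\<in>S. snd v < bgen N S)"

definition gmax :: "'a splx \<Rightarrow> int" where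
  "gmax S = Max (snd ` S)"

text \<open>The sum of the levels of all vertices but the lowest one grows by exactly one in every
  bisection, so that it counts the bisections leading to \<open>S\<close>.\<close>
definition psi :: "nat \<Rightarrow> 'a splx \<Rightarrow> int" where
  "psi N S = (\<Sum>v\<in>S. lev N (snd v)) - Min ((\<lambda>v. lev N (snd v)) ` S)"

definition vol :: "('a::euclidean_space) splx \<Rightarrow> real" where
  "vol S = measure lebesgue (hull_of S)"

lemma goodD:
  fixes S :: "'a::euclidean_space splx"
  assumes "good N S"
  shows "finite S" "card S = DIM('a) + 1" "inj_on fst S" "\<not> affine_dependent (fst ` S)"
    "inj_on snd S" "\<And>v. v \<in> S \<Longrightarrow> snd v < bgen N S" "card S \<ge> 2" "S \<noteq> {}" "card (fst ` S) = DIM('a) + 1"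
proof -
  show 1: "finite S" "card S = DIM('a) + 1" "inj_on fst S" "\<not> affine_dependent (fst ` S)"
    "inj_on snd S" "\<And>v. v \<in> S \<Longrightarrow> snd v < bgen N S"
    using assms by (auto simp: good_def)
  show "card S \<ge> 2" "S \<noteq> {}" using 1(2) DIM_positive[where 'a='a] by (auto simp: Suc_leI)
  show "card (fst ` S) = DIM('a) + 1" using 1 by (simp add: card_image)
qed

lemma bisec_data_cases:
  fixes S :: "'a::euclidean_space splx"
  assumes "N > 0" "finite S" "inj_on snd S" "card S \<ge> 2"
  obtains a b where "low_edge N S a b" "a \<noteq> b" "bse N S = {a, b}"
    "bsv N S = (mid (fst a) (fst b), mid_gen N (snd a) (snd b))"
    "bgen N S = mid_gen N (snd a) (snd b)"
    "children N S = {insert (bsv N S) (S - {a}), insert (bsv N S) (S - {b})}"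
proof -
  obtain a b where ab: "bisec_data N S = (a, b, mid_gen N (snd a) (snd b))" "low_edge N S a b"
    using bisec_data_edge[OF assms] .
  show ?thesis
    by (rule that[OF ab(2)]) (use ab in \<open>auto simp: bse_def bsv_def bgen_def children_def low_edge_def\<close>)
qed

text \<open>\<open>bse\<close> is an unordered pair, so the endpoints may be named in either order;
  the midpoint and the pair of children are symmetric in them.\<close>

lemma bse_edge:
  fixes S :: "'a::euclidean_space splx"
  assumes N: "N > 0" and g: "good N S" and e: "bse N S = {a, b}" "a \<noteq> b"
  shows "a \<in> S" "b \<in> S" "fst (bsv N S) = mid (fst a) (fst b)" "fst a \<noteq> fst b"
    "children N S = {insert (bsv N S) (S - {a}), insert (bsv N S) (S - {b})}"
    "fst (bsv N S) \<notin> fst ` S" "bsv N S \<notin> S"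
proof -
  obtain c d where cd: "low_edge N S c d" "c \<noteq> d" "bse N S = {c, d}"
    "bsv N S = (mid (fst c) (fst d), mid_gen N (snd c) (snd d))"
    "children N S = {insert (bsv N S) (S - {c}), insert (bsv N S) (S - {d})}"
    using bisec_data_cases[OF N goodD(1,5,7)[OF g]] by metis
  have *: "(c = a \<and> d = b) \<or> (c = b \<and> d = a)" using cd e by (auto simp: doubleton_eq_iff)
  then show ab: "a \<in> S" "b \<in> S" using cd(1) by (auto simp: low_edge_def)
  show m: "fst (bsv N S) = mid (fst a) (fst b)" using * cd(4) by (auto simp: add.commute)
  show "children N S = {insert (bsv N S) (S - {a}), insert (bsv N S) (S - {b})}" using * cd(5) by auto
  show ne: "fst a \<noteq> fst b" using ab e goodD(3)[OF g] by (auto dest: inj_onD)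
  show "fst (bsv N S) \<notin> fst ` S" unfolding m
    by (rule mid_notin_set) (use goodD[OF g] ab ne in auto)
  then show "bsv N S \<notin> S" by blast
qed

lemma bse_cases:
  fixes S :: "'a::euclidean_space splx"
  assumes "N > 0" "good N S"
  obtains a b where "bse N S = {a, b}" "a \<noteq> b"
  using bisec_data_cases[OF assms(1) goodD(1,5,7)[OF assms(2)]] by metis

lemma low_edge_unique:
  assumes "{a, b} = {a', b'}" "snd b < (snd a :: int)" "snd b' < snd a'"
  shows "a = a'" "b = b'"
  using assms by (metis doubleton_eq_iff order_less_asym)+

text \<open>The generations order the endpoints of the edge and then determine that of the midpoint.
  Hence all simplices of a compatible patch receive the same labelled vertex.\<close>

lemma bsv_eq:
  fixes S S' :: "'a::euclidean_space splx"
  assumes N: "N > 0" and g: "good N S" "good N S'" and e: "bse N S = bse N S'"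
  shows "bsv N S = bsv N S'"
proof -
  obtain a b where ab: "low_edge N S a b" "bse N S = {a, b}"
    "bsv N S = (mid (fst a) (fst b), mid_gen N (snd a) (snd b))"
    using bisec_data_cases[OF N goodD(1,5,7)[OF g(1)]] by metis
  obtain c d where cd: "low_edge N S' c d" "bse N S' = {c, d}"
    "bsv N S' = (mid (fst c) (fst d), mid_gen N (snd c) (snd d))"
    using bisec_data_cases[OF N goodD(1,5,7)[OF g(2)]] by metis
  have "a = c" "b = d"
    using low_edge_unique[of a b c d] ab cd e by (auto simp: low_edge_def)
  then show ?thesis using ab cd by simp
qed

text \<open>The generation attached to an edge depends on the edge alone. In \<open>T'\<close> the
  edge \<open>bse N T\<close> is a competitor of \<open>bse N T'\<close> and loses strictly.\<close>

lemma bgen_less_edge: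
  fixes T T' :: "'a::euclidean_space splx"
  assumes N: "N > 0" and g: "good N T" "good N T'" and e: "bse N T \<subseteq> T'" "bse N T' \<noteq> bse N T"
  shows "bgen N T' < bgen N T"
proof -
  obtain a b where ab: "low_edge N T a b" "bse N T = {a, b}" "bgen N T = mid_gen N (snd a) (snd b)"
    using bisec_data_cases[OF N goodD(1,5,7)[OF g(1)]] by metis
  obtain c d where cd: "low_edge N T' c d" "bse N T' = {c, d}" "bgen N T' = mid_gen N (snd c) (snd d)"
    using bisec_data_cases[OF N goodD(1,5,7)[OF g(2)]] by metis
  have "(a, b) \<noteq> (c, d)" using ab cd e by auto
  then show ?thesis using mid_gen_minimal[OF N cd(1) goodD(5)[OF g(2)], of a b] ab cd e
    by (auto simp: low_edge_def)
qed

lemma lev_s_gmax: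
  assumes "N > 0" "finite S" "S \<noteq> {}"
  shows "lev_s N S = lev N (gmax S)"
proof -
  have "mono (lev N)" using lev_mono[OF assms(1)] by (auto simp: mono_def)
  then show ?thesis unfolding lev_s_def gmax_def
    using mono_Max_commute[of "lev N" "snd ` S"] assms by (simp add: image_image)
qed

lemma lev_bgen_le:
  fixes S :: "'a::euclidean_space splx"
  assumes N: "N > 0" and g: "good N S"
  shows "lev N (bgen N S) \<le> lev_s N S + 1"
proof -
  obtain a b where ab: "low_edge N S a b" "bgen N S = mid_gen N (snd a) (snd b)"
    using bisec_data_cases[OF N goodD(1,5,7)[OF g(1)]] by metis
  have "lev N (snd a) \<le> lev_s N S" unfolding lev_s_def
    using ab goodD[OF g] by (auto simp: low_edge_def intro!: Max_ge)
  then show ?thesis using ab lev_mid_gen[OF N, of "snd b" "snd a"] by (auto simp: low_edge_def)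
qed

lemma children_props:
  fixes S :: "'a::euclidean_space splx"
  assumes N: "N > 0" and g: "good N S" and C: "C \<in> children N S" and dim: "DIM('a) \<ge> 2"
  shows "good N C" "bgen N S < bgen N C" "gmax C = bgen N S" "psi N C = psi N S + 1"
    "vol S \<le> 2 * vol C" "hull_of C \<subseteq> hull_of S" "\<not> hull_of S \<subseteq> hull_of C" "bsv N S \<in> C"
proof -
  let ?w = "bsv N S"
  note gD = goodD[OF g]
  obtain p q where pq: "low_edge N S p q" "p \<noteq> q" "bse N S = {p, q}" "snd ?w = bgen N S"
    "bgen N S = mid_gen N (snd p) (snd q)" "children N S = {insert ?w (S - {p}), insert ?w (S - {q})}"
    using bisec_data_cases[OF N gD(1,5,7)] by (metis snd_conv)
  obtain a b where ab: "{a, b} = {p, q}" "C = insert ?w (S - {a})" using C pq(6) by (metis (no_types) insert_commute insert_iff singletonD)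
  have e: "bse N S = {a, b}" "a \<noteq> b" using ab pq by (auto simp: doubleton_eq_iff)
  note be = bse_edge[OF N g e]
  have fC: "fst ` C = insert (mid (fst a) (fst b)) (fst ` S - {fst a})"
    using be gD(3) unfolding ab(2) by (auto simp: be(3)[symmetric] dest: inj_onD)
  show w: "?w \<in> C" using ab by simp
  have fin: "finite C" using ab gD by simp
  have S': "S - {a} \<subseteq> S" by auto
  have lt: "snd v < snd ?w" if "v \<in> S" for v using gD(6)[OF that] pq by simp
  have cardC: "card C = DIM('a) + 1" using ab be gD by (simp add: card_insert_if card_Diff_singleton)
  have injf: "inj_on fst C" using be(6) inj_on_subset[OF gD(3) S'] unfolding ab(2) by (auto simp: inj_on_insert)
  have injs: "inj_on snd C" using lt inj_on_subset[OF gD(5) S'] unfolding ab(2)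
    by (auto simp: inj_on_insert) (metis less_irrefl snd_conv)
  have aff: "\<not> affine_dependent (fst ` C)" unfolding fC
    by (rule affine_independent_half) (use gD be in auto)
  have card2: "card C \<ge> 2" using cardC dim by simp
  obtain x y where xy: "low_edge N C x y" "bgen N C = mid_gen N (snd x) (snd y)"
    using bisec_data_cases[OF N fin injs card2] by metis
  have le: "snd v \<le> snd ?w" if "v \<in> C" for v using that lt[of v] unfolding ab(2) by auto
  \<comment> \<open>If the next bisection edge contains the midpoint, then as its newer endpoint,
    and \<open>mid_gen_gt\<close> applies. Otherwise it is an edge of \<open>S\<close> other than
    the bisection edge, one endpoint of which is gone, and minimality in \<open>S\<close>
    applies.\<close>
  show bg: "bgen N S < bgen N C"
  proof (cases "x = ?w")
    case True
    then show ?thesis using mid_gen_gt[OF N, of "snd y" "snd x"] xy pq by (simp add: low_edge_def)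
  next
    case False
    have "x \<in> C" "snd y < snd x" using xy by (auto simp: low_edge_def)
    then have "y \<noteq> ?w" using le[of x] by auto
    then have "x \<in> S - {a}" "y \<in> S - {a}" using xy False unfolding ab(2) by (auto simp: low_edge_def)
    moreover have "(x, y) \<noteq> (p, q)" using calculation ab by auto
    ultimately show ?thesis using mid_gen_minimal[OF N pq(1) gD(5), of x y] xy pq
      by (auto simp: low_edge_def)
  qed
  show "good N C" unfolding good_def
    using fin cardC injf aff injs bg le pq by force
  show "gmax C = bgen N S" unfolding gmax_def pq(4)[symmetric] using fin w le by (intro Max_eqI) auto
  have levw: "lev N (snd ?w) = lev N (snd p) + 1"
    using lev_mid_gen[OF N, of "snd q" "snd p"] pq by (simp add: low_edge_def)
  have minS: "Min ((\<lambda>v. lev N (snd v)) ` S) = lev N (snd q)"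
    using gD pq(1) lev_mono[OF N] by (intro Min_eqI) (auto simp: low_edge_def)
  have sumC: "(\<Sum>v\<in>C. lev N (snd v)) = lev N (snd ?w) + (\<Sum>v\<in>S. lev N (snd v)) - lev N (snd a)"
    unfolding ab(2) using gD be by (simp add: sum_diff1)
  \<comment> \<open>Replacing \<open>p\<close> raises the sum by 1 and keeps the minimum lev q.
    Replacing \<open>q\<close> raises the sum by lev p + 1 - lev q and the minimum from lev q to lev
    p. Subtracting the minimum makes both children agree.\<close>
  show "psi N C = psi N S + 1"
  proof (cases "a = p")
    case True
    then have "b = q" using ab(1) e(2) by (auto simp: doubleton_eq_iff)
    have "Min ((\<lambda>v. lev N (snd v)) ` C) = lev N (snd q)"
    proof (intro Min_eqI)
      show "lev N (snd q) \<in> (\<lambda>v. lev N (snd v)) ` C" using be \<open>b = q\<close> e unfolding ab(2) by auto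
      fix l assume "l \<in> (\<lambda>v. lev N (snd v)) ` C"
      then obtain v where v: "v \<in> C" "l = lev N (snd v)" by auto
      have "snd q \<le> snd v" using v(1) pq(1) lt[of q] unfolding ab(2)
        by (auto simp: low_edge_def intro: less_imp_le)
      then show "lev N (snd q) \<le> l" using lev_mono[OF N] v by simp
    qed (use fin in auto)
    then show ?thesis using sumC minS levw True by (simp add: psi_def)
  next
    case False
    then have aq: "a = q" "b = p" using ab(1) e(2) by (auto simp: doubleton_eq_iff)
    have "Min ((\<lambda>v. lev N (snd v)) ` C) = lev N (snd p)"
    proof (intro Min_eqI)
      show "lev N (snd p) \<in> (\<lambda>v. lev N (snd v)) ` C" using be aq e unfolding ab(2) by auto
      fix l assume "l \<in> (\<lambda>v. lev N (snd v)) ` C"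
      then obtain v where v: "v \<in> C" "l = lev N (snd v)" by auto
      show "lev N (snd p) \<le> l"
        using v pq(1) aq levw unfolding ab(2) by (auto simp: low_edge_def)
    qed (use fin in auto)
    then show ?thesis using sumC minS levw aq by (simp add: psi_def)
  qed
  have half: "hull_of C = convex hull (insert (mid (fst a) (fst b)) (fst ` S - {fst a}))"
    by (simp add: hull_of_def fC)
  have nin: "mid (fst a) (fst b) \<notin> fst ` S" using be by simp
  show "vol S \<le> 2 * vol C" unfolding vol_def half unfolding hull_of_def
    by (rule measure_half) (use gD be dim in auto)
  show "hull_of C \<subseteq> hull_of S" unfolding half unfolding hull_of_def
    using hull_half_Un[of "fst ` S" "fst a" "fst b"] gD be nin by auto
  have "fst a \<in> hull_of S" using be by (auto simp: hull_of_def intro: hull_inc)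
  moreover have "fst a \<notin> hull_of C" unfolding half
    by (rule removed_vertex_notin_half) (use gD be in auto)
  ultimately show "\<not> hull_of S \<subseteq> hull_of C" by blast
qed

lemma hull_of_children:
  fixes S :: "'a::euclidean_space splx"
  assumes N: "N > 0" and g: "good N S"
  shows "hull_of S = \<Union> (hull_of ` children N S)"
proof -
  obtain a b where e: "bse N S = {a, b}" "a \<noteq> b" using bse_cases[OF N g] .
  note be = bse_edge[OF N g e] and gD = goodD[OF g]
  have "fst ` (insert (bsv N S) (S - {a})) = insert (mid (fst a) (fst b)) (fst ` S - {fst a})"
    "fst ` (insert (bsv N S) (S - {b})) = insert (mid (fst a) (fst b)) (fst ` S - {fst b})"
    using be gD(3) by (auto simp: be(3)[symmetric] dest: inj_onD)
  then show ?thesis unfolding be(5) hull_of_def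
    using hull_half_Un[of "fst ` S" "fst a" "fst b"] gD be by simp
qed

text \<open>Subtracting the minimum discards one of the n + 1 vertices. The factor n, rather than n
  + 1, is what makes the volume of a simplex bounded below by the n-th power of its mesh
  size.\<close>

lemma psi_le:
  fixes S :: "'a::euclidean_space splx"
  assumes N: "N > 0" and g: "good N S"
  shows "psi N S \<le> int DIM('a) * lev_s N S"
proof -
  note gD = goodD[OF g]
  let ?f = "\<lambda>v. lev N (snd v)"
  have "Min (?f ` S) \<in> ?f ` S" using gD by (intro Min_in) auto
  then obtain v where v: "v \<in> S" "Min (?f ` S) = ?f v" by auto
  have "psi N S = (\<Sum>v\<in>S - {v}. ?f v)" unfolding psi_def using v gD by (simp add: sum_diff1)
  also have "\<dots> \<le> (\<Sum>x\<in>S - {v}. lev_s N S)"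
    unfolding lev_s_def using gD by (intro sum_mono) auto
  also have "\<dots> = int DIM('a) * lev_s N S" using v gD by (simp add: card_Diff_singleton)
  finally show ?thesis .
qed

section \<open>Conformity\<close>

text \<open>The intersection is taken among labelled vertices, so the condition includes that a
  common vertex carries the same generation in both simplices. Disjoint vertex sets force disjoint
  hulls, and the reverse inclusion always holds.\<close>

definition conform :: "('a::euclidean_space) splx set \<Rightarrow> bool" where
  "conform \<T> \<longleftrightarrow> (\<forall>A\<in>\<T>. \<forall>B\<in>\<T>. hull_of A \<inter> hull_of B \<subseteq> hull_of (A \<inter> B))"

definition bisected :: "nat \<Rightarrow> ('a::real_vector) splx set \<Rightarrow> 'a splx \<Rightarrow> 'a splx set" where
  "bisected N \<T> e = (\<T> - patch \<T> e) \<union> \<Union> (children N ` patch \<T> e)"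

lemma hull_of_mono: "A \<subseteq> B \<Longrightarrow> hull_of A \<subseteq> hull_of B"
  by (simp add: hull_of_def hull_mono image_mono)

lemma in_hull_of: "v \<in> A \<Longrightarrow> fst v \<in> hull_of A"
  by (simp add: hull_of_def hull_inc)

lemma vertex_in_hull_of:
  assumes "good N A" "I \<subseteq> A" "v \<in> A" "fst v \<in> hull_of I"
  shows "v \<in> I"
proof -
  have "fst v \<in> fst ` I"
    by (rule vertex_in_hull[of "fst ` A"]) (use assms goodD[OF assms(1)] in \<open>auto simp: hull_of_def\<close>)
  then obtain u where "u \<in> I" "fst u = fst v" by auto
  then show ?thesis using assms(2,3) inj_onD[OF goodD(3)[OF assms(1)], of u v] by auto
qed

lemma hull_of_Int_child:
  fixes A :: "'a::euclidean_space splx"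
  assumes N: "N > 0" and g: "good N A" and e: "bse N A = {a, b}" "a \<noteq> b" and I: "I \<subseteq> A"
    and p: "p \<in> hull_of I" "p \<in> hull_of (insert (bsv N A) (A - {a}))"
  shows "\<not> (a \<in> I \<and> b \<in> I) \<Longrightarrow> p \<in> hull_of (I - {a})"
    and "a \<in> I \<Longrightarrow> b \<in> I \<Longrightarrow> p \<in> hull_of (insert (bsv N A) (I - {a}))"
    and "a \<in> I \<Longrightarrow> b \<in> I \<Longrightarrow> p \<in> hull_of (insert (bsv N A) (A - {b})) \<Longrightarrow>
           p \<in> hull_of (insert (bsv N A) (I - {a,b}))"
proof -
  note be = bse_edge[OF N g e] and gD = goodD[OF g]
  have im: "fst ` (J - {x}) = fst ` J - {fst x}" if "J \<subseteq> A" "x \<in> A" for J x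
    using gD(3) that by (auto dest: inj_onD)
  have im2: "fst ` (I - {a,b}) = fst ` I - {fst a, fst b}"
    using gD(3) I be(1,2) by (auto dest: inj_onD)
  have mem: "x \<in> I \<longleftrightarrow> fst x \<in> fst ` I" if "x \<in> A" for x
    using gD(3) that I by (auto dest: inj_onD)
  have pI: "p \<in> convex hull (fst ` I)" using p by (simp add: hull_of_def)
  have pA: "p \<in> convex hull (insert (mid (fst a) (fst b)) (fst ` A - {fst a}))"
    using p(2) by (simp add: hull_of_def im be)
  have IA: "fst ` I \<subseteq> fst ` A" using I by auto
  have fA: "finite (fst ` A)" using gD by simp
  note H = hull_Int_half[OF fA gD(4) _ _ be(4) IA pI pA]
  have ab: "fst a \<in> fst ` A" "fst b \<in> fst ` A" using be by auto
  show "p \<in> hull_of (I - {a})" if "\<not> (a \<in> I \<and> b \<in> I)"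
    using H(1)[OF ab] that mem be I by (simp add: hull_of_def im)
  assume abI: "a \<in> I" "b \<in> I"
  then have abI': "fst a \<in> fst ` I" "fst b \<in> fst ` I" by auto
  show "p \<in> hull_of (insert (bsv N A) (I - {a}))"
    using H(2)[OF ab abI'] be I by (simp add: hull_of_def im)
  assume "p \<in> hull_of (insert (bsv N A) (A - {b}))"
  then have "p \<in> convex hull (insert (mid (fst a) (fst b)) (fst ` A - {fst b}))"
    by (simp add: hull_of_def im be)
  then show "p \<in> hull_of (insert (bsv N A) (I - {a,b}))"
    using H(3)[OF ab abI'] by (simp add: hull_of_def im2 be)
qed

lemma child_cases:
  fixes A :: "'a::euclidean_space splx"
  assumes "N > 0" "good N A" "C \<in> children N A"
  obtains x y where "bse N A = {x, y}" "x \<noteq> y" "C = insert (bsv N A) (A - {x})"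
proof -
  obtain a b where e: "bse N A = {a, b}" "a \<noteq> b" using bse_cases[OF assms(1,2)] .
  have "C = insert (bsv N A) (A - {a}) \<or> C = insert (bsv N A) (A - {b})"
    using assms(3) bse_edge(5)[OF assms(1,2) e] by simp
  then show ?thesis using that[of a b] that[of b a] e by (auto simp: insert_commute)
qed

text \<open>A simplex outside the patch does not contain the edge, so its common face with a patch
  simplex lacks an endpoint and survives in the children. Two patch simplices share the midpoint:
  their children on the same side share one half of the common face, those on opposite sides the
  midpoint and the face without the edge.\<close>

lemma conform_bisected:
  fixes \<T> :: "'a::euclidean_space splx set"
  assumes N: "N > 0" and g: "\<And>T. T \<in> \<T> \<Longrightarrow> good N T" and c: "conform \<T>"
    and e: "\<And>T. T \<in> patch \<T> e \<Longrightarrow> bse N T = e" and dim: "DIM('a) \<ge> 2"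
  shows "conform (bisected N \<T> e)"
proof -
  have sub: "hull_of C \<subseteq> hull_of A" if "A \<in> \<T>" "C \<in> children N A" for A C
    using children_props(6)[OF N g[OF that(1)] that(2) dim] .
  have mixed: "hull_of C \<inter> hull_of B \<subseteq> hull_of (C \<inter> B)"
    if mx: "A \<in> patch \<T> e" "C \<in> children N A" "B \<in> \<T> - patch \<T> e" for A B C
  proof
    fix p assume p: "p \<in> hull_of C \<inter> hull_of B"
    have A: "A \<in> \<T>" using mx by (simp add: patch_def)
    obtain x y where xy: "bse N A = {x, y}" "x \<noteq> y" "C = insert (bsv N A) (A - {x})"
      using child_cases[OF N g[OF A] mx(2)] .
    have "p \<in> hull_of (A \<inter> B)" using p sub[OF A mx(2)] c A mx by (auto simp: conform_def)
    moreover have "\<not> (x \<in> A \<inter> B \<and> y \<in> A \<inter> B)" using mx e[OF mx(1)] xy by (auto simp: patch_def)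
    ultimately have "p \<in> hull_of ((A \<inter> B) - {x})"
      using hull_of_Int_child(1)[OF N g[OF A] xy(1,2), of "A \<inter> B" p] p xy by auto
    moreover have "A \<inter> B - {x} \<subseteq> C \<inter> B" using xy by auto
    ultimately show "p \<in> hull_of (C \<inter> B)" using hull_of_mono by blast
  qed
  have both: "hull_of C \<inter> hull_of D \<subseteq> hull_of (C \<inter> D)"
    if AB: "A \<in> patch \<T> e" "C \<in> children N A" "B \<in> patch \<T> e" "D \<in> children N B" for A B C D
  proof
    fix p assume p: "p \<in> hull_of C \<inter> hull_of D"
    have A: "A \<in> \<T>" and B: "B \<in> \<T>" using AB by (auto simp: patch_def)
    have w: "bsv N A = bsv N B" by (rule bsv_eq) (use N A B g e AB in auto)
    obtain x y where xy: "bse N A = {x, y}" "x \<noteq> y" "C = insert (bsv N A) (A - {x})"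
      using child_cases[OF N g[OF A] AB(2)] .
    obtain x' y' where xy': "bse N B = {x', y'}" "x' \<noteq> y'" "D = insert (bsv N B) (B - {x'})"
      using child_cases[OF N g[OF B] AB(4)] .
    have ee: "{x, y} = e" "{x', y'} = e" using xy xy' e AB by auto
    have pI: "p \<in> hull_of (A \<inter> B)" using p sub[OF A AB(2)] sub[OF B AB(4)] c A B unfolding conform_def by blast
    have I: "x \<in> A \<inter> B" "y \<in> A \<inter> B" using AB ee by (auto simp: patch_def)
    have pC: "p \<in> hull_of (insert (bsv N A) (A - {x}))" using p xy by simp
    show "p \<in> hull_of (C \<inter> D)"
    proof (cases "x' = x")
      case True
      have "p \<in> hull_of (insert (bsv N A) (A \<inter> B - {x}))"
        using hull_of_Int_child(2)[OF N g[OF A] xy(1,2) _ pI pC I] by simp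
      moreover have "insert (bsv N A) (A \<inter> B - {x}) \<subseteq> C \<inter> D" using xy xy' True w by auto
      ultimately show ?thesis using hull_of_mono by blast
    next
      case False
      then have x': "x' = y" "y' = x" using ee xy'(2) by (auto simp: doubleton_eq_iff)
      have "p \<in> hull_of (insert (bsv N B) (A \<inter> B - {y}))"
        using hull_of_Int_child(2)[OF N g[OF B] xy'(1,2), of "A \<inter> B" p] pI p xy' x' I by auto
      then have "p \<in> hull_of (insert (bsv N A) (A - {y}))"
        using hull_of_mono[of "insert (bsv N B) (A \<inter> B - {y})" "insert (bsv N A) (A - {y})"] w by auto
      then have "p \<in> hull_of (insert (bsv N A) (A \<inter> B - {x,y}))"
        using hull_of_Int_child(3)[OF N g[OF A] xy(1,2) _ pI pC I] by simp
      moreover have "insert (bsv N A) (A \<inter> B - {x,y}) \<subseteq> C \<inter> D" using xy xy' x' w by auto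
      ultimately show ?thesis using hull_of_mono by blast
    qed
  qed
  show ?thesis unfolding conform_def
  proof (intro ballI)
    fix C D assume CD: "C \<in> bisected N \<T> e" "D \<in> bisected N \<T> e"
    consider "C \<in> \<T> - patch \<T> e" "D \<in> \<T> - patch \<T> e"
      | A where "A \<in> patch \<T> e" "C \<in> children N A" "D \<in> \<T> - patch \<T> e"
      | B where "C \<in> \<T> - patch \<T> e" "B \<in> patch \<T> e" "D \<in> children N B"
      | A B where "A \<in> patch \<T> e" "C \<in> children N A" "B \<in> patch \<T> e" "D \<in> children N B"
      using CD unfolding bisected_def by blast
    then show "hull_of C \<inter> hull_of D \<subseteq> hull_of (C \<inter> D)"
    proof cases
      case 1 then show ?thesis using c by (auto simp: conform_def)
    next
      case 2 then show ?thesis using mixed by blast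
    next
      case 3 then show ?thesis using mixed[of B D C] by (simp add: Int_commute)
    next
      case 4 then show ?thesis using both by blast
    qed
  qed
qed

lemma negligible_hull_card:
  fixes Q :: "'a::euclidean_space set"
  assumes "finite Q" "card Q \<le> DIM('a)"
  shows "negligible (convex hull Q)"
proof -
  have "aff_dim (convex hull Q) < DIM('a)"
    using aff_dim_le_card[OF assms(1)] assms(2) by (simp add: aff_dim_convex_hull)
  then have "interior (convex hull Q) = {}" using aff_dim_nonempty_interior by fastforce
  then show ?thesis by (simp add: negligible_convex_interior)
qed

lemma good_not_negligible:
  fixes A :: "'a::euclidean_space splx"
  assumes "good N A" shows "interior (hull_of A) \<noteq> {}" "\<not> negligible (hull_of A)"
proof -
  show "interior (hull_of A) \<noteq> {}" unfolding hull_of_def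
    using interior_convex_hull_eq_empty[of "fst ` A"] goodD[OF assms] by simp
  then show "\<not> negligible (hull_of A)"
    by (simp add: hull_of_def negligible_convex_interior)
qed

lemma conform_negligible:
  fixes A B :: "'a::euclidean_space splx"
  assumes "good N A" "good N B" "A \<noteq> B" "conform \<T>" "A \<in> \<T>" "B \<in> \<T>"
  shows "negligible (hull_of A \<inter> hull_of B)"
proof -
  note gA = goodD[OF assms(1)] and gB = goodD[OF assms(2)]
  have "A \<inter> B \<subset> A"
  proof (rule psubsetI)
    show "A \<inter> B \<noteq> A"
    proof
      assume "A \<inter> B = A"
      then have "A \<subseteq> B" by blast
      then show False using card_subset_eq[of B A] gA(2) gB(1,2) assms(3) by simp
    qed
  qed simp
  then have "card (A \<inter> B) \<le> DIM('a)" using psubset_card_mono[of A "A \<inter> B"] gA by simp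
  then have "card (fst ` (A \<inter> B)) \<le> DIM('a)" using card_image_le[of "A \<inter> B" fst] gA by simp
  then have "negligible (hull_of (A \<inter> B))" unfolding hull_of_def
    using gA by (intro negligible_hull_card) auto
  then show ?thesis using assms negligible_subset unfolding conform_def by blast
qed

section \<open>The refinement forest\<close>

inductive desc :: "nat \<Rightarrow> ('a::real_vector) splx \<Rightarrow> 'a splx \<Rightarrow> bool" for N :: nat where
  desc_refl: "desc N A A"
| desc_step: "desc N A B \<Longrightarrow> C \<in> children N B \<Longrightarrow> desc N A C"

lemma desc_trans: "desc N B C \<Longrightarrow> desc N A B \<Longrightarrow> desc N A C"
  by (induction rule: desc.induct) (auto intro: desc.intros)

lemma desc_top: "desc N A B \<Longrightarrow> A \<noteq> B \<Longrightarrow> \<exists>C\<in>children N A. desc N C B"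
proof (induction rule: desc.induct)
  case (desc_step A B C)
  then show ?case
  proof (cases "A = B")
    case True
    then show ?thesis using desc_step(2) desc_refl by blast
  next
    case False
    then show ?thesis using desc_step desc.desc_step by blast
  qed
qed simp

lemma desc_props:
  fixes A B :: "'a::euclidean_space splx"
  assumes "desc N A B" and N: "N > 0" and "good N A" and dim: "DIM('a) \<ge> 2"
  shows "good N B \<and> hull_of B \<subseteq> hull_of A \<and> psi N A \<le> psi N B \<and>
    vol A \<le> 2 ^ nat (psi N B - psi N A) * vol B \<and> (A \<noteq> B \<longrightarrow> bgen N A \<le> gmax B) \<and> bgen N A \<le> bgen N B"
  using assms(1,3)
proof (induction rule: desc.induct)
  case (desc_refl A)
  then show ?case by auto
next
  case (desc_step A B C)
  then have IH: "good N B" "hull_of B \<subseteq> hull_of A" "psi N A \<le> psi N B"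
    "vol A \<le> 2 ^ nat (psi N B - psi N A) * vol B" "bgen N A \<le> bgen N B" by auto
  note cp = children_props[OF N IH(1) desc_step.hyps(2) dim]
  have "vol A \<le> 2 ^ nat (psi N B - psi N A) * (2 * vol C)"
    by (rule order_trans[OF IH(4) mult_left_mono[OF cp(5)]]) simp
  also have "\<dots> = 2 ^ Suc (nat (psi N B - psi N A)) * vol C" by simp
  also have "Suc (nat (psi N B - psi N A)) = nat (psi N C - psi N A)" using IH(3) cp(4) by simp
  finally show ?case using IH cp by auto
qed

lemma desc_hull_eq:
  fixes A B :: "'a::euclidean_space splx"
  assumes "desc N A B" "N > 0" "good N A" "DIM('a) \<ge> 2" "hull_of A \<subseteq> hull_of B"
  shows "A = B"
proof (rule ccontr)
  assume "A \<noteq> B"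
  then obtain C where C: "C \<in> children N A" "desc N C B" using desc_top[OF assms(1)] by blast
  note cp = children_props[OF assms(2,3) C(1) assms(4)]
  then show False using desc_props[OF C(2) assms(2) cp(1) assms(4)] assms(5) cp by blast
qed

text \<open>\<open>reach N \<S> T C\<close>: \<open>C\<close> is one of the children produced by the recursive calls of Refine started at \<open>T\<close>.\<close>
inductive reach :: "nat \<Rightarrow> ('a::real_vector) splx set \<Rightarrow> 'a splx \<Rightarrow> 'a splx \<Rightarrow> bool"
  for N :: nat and \<S> :: "'a splx set" where
  reach_base: "T \<in> \<S> \<Longrightarrow> T' \<in> \<S> \<Longrightarrow> bse N T \<subseteq> T' \<Longrightarrow> bse N T' = bse N T \<Longrightarrow> C \<in> children N T' \<Longrightarrow>
     reach N \<S> T C"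
| reach_step: "T \<in> \<S> \<Longrightarrow> T' \<in> \<S> \<Longrightarrow> bse N T \<subseteq> T' \<Longrightarrow> bse N T' \<noteq> bse N T \<Longrightarrow> reach N \<S> T' C \<Longrightarrow>
     reach N \<S> T C"

lemma refines_refl: "refines \<X> \<X>" by (auto simp: refines_def)

lemma refines_trans: "refines \<X> \<Y> \<Longrightarrow> refines \<Y> \<Z> \<Longrightarrow> refines \<X> \<Z>"
  unfolding refines_def by (meson order_trans)

text \<open>The coloring enters through these facts. Level 0 and nonnegative \<open>psi\<close> at
  the start make \<open>psi\<close> of a descendant an upper bound for the number of its
  bisections.\<close>

locale initial_mesh =
  fixes N :: nat and \<T>0 :: "'a::euclidean_space splx set"
  assumes N_pos: "N > 0" and dim: "DIM('a) \<ge> 2" and finite_init: "finite \<T>0"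
    and good_init: "\<And>T. T \<in> \<T>0 \<Longrightarrow> good N T" and conform_init: "conform \<T>0"
    and lev_init: "\<And>T. T \<in> \<T>0 \<Longrightarrow> lev_s N T = 0" and psi_init: "\<And>T. T \<in> \<T>0 \<Longrightarrow> 0 \<le> psi N T"
begin

text \<open>The nodes of the full bisection forest, closed under taking children irrespective of
  conformity. Simplices of different triangulations become comparable by ancestry.\<close>

definition node :: "'a splx \<Rightarrow> bool" where
  "node T \<longleftrightarrow> (\<exists>R\<in>\<T>0. desc N R T)"

lemma node_good: "node T \<Longrightarrow> good N T"
  unfolding node_def by (elim bexE) (simp add: desc_props[OF _ N_pos good_init dim])

lemma node_desc: "node A \<Longrightarrow> desc N A B \<Longrightarrow> node B"
  unfolding node_def using desc_trans by blast

lemma node_child: "node A \<Longrightarrow> B \<in> children N A \<Longrightarrow> node B"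
  using node_desc desc_step[OF desc_refl] by blast

lemma bse_subset:
  assumes "node T"
  shows "bse N T \<subseteq> T"
proof -
  obtain a b where e: "bse N T = {a, b}" "a \<noteq> b" using bse_cases[OF N_pos node_good[OF assms]] .
  then show ?thesis using bse_edge(1,2)[OF N_pos node_good[OF assms] e] by simp
qed

lemma hull_desc: "node A \<Longrightarrow> desc N A B \<Longrightarrow> hull_of B \<subseteq> hull_of A"
  by (simp add: desc_props[OF _ N_pos node_good dim])

lemma node_hull_eq: "node A \<Longrightarrow> desc N A B \<Longrightarrow> hull_of A \<subseteq> hull_of B \<Longrightarrow> A = B"
  by (rule desc_hull_eq[OF _ N_pos node_good dim])

lemma desc_antisym: "node A \<Longrightarrow> desc N A B \<Longrightarrow> desc N B A \<Longrightarrow> A = B"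
  by (rule node_hull_eq) (auto dest: node_desc hull_desc)

text \<open>The single simplex \<open>P\<close> is a conforming mesh whose bisection consists of its
  children, so the general fact about conforming meshes applies.\<close>

lemma siblings_negligible:
  assumes "node P" "C \<in> children N P" "D \<in> children N P" "C \<noteq> D"
  shows "negligible (hull_of C \<inter> hull_of D)"
proof -
  have P: "patch {P} (bse N P) = {P}" using bse_subset[OF assms(1)] by (auto simp: patch_def)
  have "conform {P}" by (simp add: conform_def)
  then have "conform (bisected N {P} (bse N P))"
    by (intro conform_bisected) (use N_pos dim node_good assms P in auto)
  then have "conform (children N P)" by (simp add: bisected_def P)
  then show ?thesis using conform_negligible node_good node_child assms by blast
qed

text \<open>As for dyadic cubes, two nodes are nested or do not overlap. The proof descends from the
  root of \<open>X\<close> with \<open>K\<close> fixed. In the step from \<open>B\<close> to its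
  child \<open>C\<close> the essential case is \<open>K\<close> strictly below \<open>B\<close>:
  then \<open>K\<close> lies below \<open>C\<close> or below the sibling of
  \<open>C\<close>.\<close>

lemma node_trichotomy:
  assumes "node X" "node K"
  shows "desc N K X \<or> desc N X K \<or> negligible (hull_of X \<inter> hull_of K)"
proof -
  obtain R where R: "R \<in> \<T>0" "desc N R X" using assms by (auto simp: node_def)
  obtain R' where R': "R' \<in> \<T>0" "desc N R' K" using assms by (auto simp: node_def)
  have nR: "node R" "node R'" using R R' by (auto simp: node_def intro: desc_refl)
  have sub: "hull_of K \<subseteq> hull_of R'" using hull_desc[OF nR(2) R'(2)] .
  have "node R \<and> R \<in> \<T>0 \<Longrightarrow> ?thesis" using R(2)
  proof (induction rule: desc.induct)
    case (desc_refl A)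
    show ?case
    proof (cases "A = R'")
      case True
      then show ?thesis using R' by blast
    next
      case False
      then have "negligible (hull_of A \<inter> hull_of R')"
        using conform_negligible[OF good_init good_init _ conform_init] desc_refl R' by blast
      then show ?thesis using negligible_subset sub by blast
    qed
  next
    case (desc_step A B C)
    have nB: "node B" using desc_step node_desc by blast
    have hC: "hull_of C \<subseteq> hull_of B" using hull_desc[OF nB] desc_step(2) desc.intros by blast
    consider "desc N K B" | "desc N B K" "K \<noteq> B" | "negligible (hull_of B \<inter> hull_of K)"
      using desc_step desc.desc_refl by blast
    then show ?case
    proof cases
      case 1 then show ?thesis using desc_step(2) desc.desc_step by blast
    next
      case 2
      then obtain D where D: "D \<in> children N B" "desc N D K" using desc_top by blast
      show ?thesis
      proof (cases "D = C")
        case True then show ?thesis using D by blast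
      next
        case False
        then have "negligible (hull_of C \<inter> hull_of D)"
          using siblings_negligible[OF nB] desc_step(2) D by blast
        then show ?thesis using negligible_subset hull_desc[OF node_child[OF nB D(1)] D(2)] by blast
      qed
    next
      case 3 then show ?thesis using negligible_subset hC by blast
    qed
  qed
  then show ?thesis using nR R by blast
qed

text \<open>\<open>refines\<close> is stated by inclusion of hulls; this turns it into
  ancestry.\<close>

lemma hull_subset_imp_desc:
  assumes "node X" "node K" "hull_of X \<subseteq> hull_of K"
  shows "desc N K X"
proof -
  have "hull_of X \<inter> hull_of K = hull_of X" using assms by blast
  then have "\<not> negligible (hull_of X \<inter> hull_of K)"
    using good_not_negligible(2)[OF node_good[OF assms(1)]] by simp
  then have "desc N K X \<or> desc N X K" using node_trichotomy assms by blast
  then show ?thesis using node_hull_eq[OF assms(1) _ assms(3)] desc_refl by blast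
qed

text \<open>That a node has only one parent is not evident from its vertices, but follows from the
  geometry: an ancestor \<open>K\<close> of \<open>X\<close> strictly below \<open>P\<close> lies
  below a child of \<open>P\<close> that overlaps \<open>X\<close>, and this child can only be
  \<open>X\<close>.\<close>

lemma desc_child:
  assumes "node P" "X \<in> children N P" "node K" "desc N K X"
  shows "K = X \<or> desc N K P"
proof -
  have nX: "node X" using node_child assms by blast
  have XK: "hull_of X \<subseteq> hull_of K" using hull_desc assms by blast
  have XP: "hull_of X \<subseteq> hull_of P" using hull_desc assms desc.intros by blast
  consider "desc N K P" | "desc N P K" "P \<noteq> K" | "negligible (hull_of P \<inter> hull_of K)"
    using node_trichotomy[OF assms(1,3)] desc_refl by blast
  then show ?thesis
  proof cases
    case 2
    then obtain C where C: "C \<in> children N P" "desc N C K" using desc_top by blast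
    have "hull_of X \<subseteq> hull_of C" using XK hull_desc[OF node_child[OF assms(1) C(1)] C(2)] by blast
    then have "\<not> negligible (hull_of X \<inter> hull_of C)"
      using good_not_negligible[OF node_good[OF nX]] by (simp add: Int_absorb2)
    then have "X = C" using siblings_negligible assms C by blast
    then show ?thesis using desc_antisym C assms by blast
  next
    case 3
    then have "negligible (hull_of X)" using XK XP negligible_subset by blast
    then show ?thesis using good_not_negligible[OF node_good[OF nX]] by blast
  qed blast
qed

text \<open>The recursion of Refine is flattened: every triangulation arises by bisecting compatible
  patches one at a time, and each intermediate mesh belongs to \<open>BB\<close>, being the result
  of a call without recursion.\<close>

lemma BB_induct [consumes 1, case_names init step]:
  assumes "\<T> \<in> BB N \<T>0" "P \<T>0"
    and step: "\<And>\<T> T. \<T> \<in> BB N \<T>0 \<Longrightarrow> P \<T> \<Longrightarrow> T \<in> \<T> \<Longrightarrow> \<forall>T'\<in>patch \<T> (bse N T). bse N T' = bse N T \<Longrightarrow>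
      P (bisected N \<T> (bse N T))"
  shows "P \<T>"
proof -
  have 1: "\<T>' \<in> BB N \<T>0 \<and> P \<T>'" if "refine1 N \<T> T \<T>'" "\<T> \<in> BB N \<T>0" "P \<T>" for \<T> T \<T>'
    using that
  proof (induction rule: refine1.induct)
    case (base T \<T>)
    have "refine1 N \<T> T (bisected N \<T> (bse N T))" unfolding bisected_def
      by (rule refine1.base) (use base(1,2) in blast)+
    then show ?case using base step[of \<T> T] BB.step[of \<T> N \<T>0 T] by (simp add: bisected_def)
  next
    case (recur T \<T> T' \<T>1 \<T>2)
    then show ?case by blast
  qed
  show ?thesis using assms(1)
  proof (induction rule: BB.induct)
    case init
    then show ?case by (rule assms(2))
  next
    case (step \<T> T \<T>')
    then show ?case using 1[of \<T> T \<T>'] by blast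
  qed
qed

lemma BB_invariants:
  assumes "\<T> \<in> BB N \<T>0"
  shows "finite \<T> \<and> (\<forall>T\<in>\<T>. node T) \<and> conform \<T> \<and> \<Union> (hull_of ` \<T>) = \<Union> (hull_of ` \<T>0)"
  using assms
proof (induction rule: BB_induct)
  case init
  then show ?case using finite_init conform_init by (auto simp: node_def intro: desc_refl)
next
  case (step \<T> T)
  let ?e = "bse N T"
  have fc: "finite (children N A)" for A :: "'a splx"
    by (simp add: children_def split: prod.split)
  have "finite (bisected N \<T> ?e)" using step.IH fc by (simp add: bisected_def patch_def)
  moreover have "\<forall>T\<in>bisected N \<T> ?e. node T" using step.IH node_child by (auto simp: bisected_def patch_def)
  moreover have "conform (bisected N \<T> ?e)"
    by (rule conform_bisected[OF N_pos _ _ _ dim]) (use step.IH step.hyps(3) node_good in blast)+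
  moreover have "\<Union> (hull_of ` bisected N \<T> ?e) = \<Union> (hull_of ` \<T>)"
  proof (rule set_eqI)
    fix x
    have h: "(\<exists>C\<in>children N A. x \<in> hull_of C) \<longleftrightarrow> x \<in> hull_of A" if "A \<in> \<T>" for A
    proof -
      have "node A" using step.IH that by simp
      then show ?thesis using hull_of_children[OF N_pos node_good, of A] by simp
    qed
    have "x \<in> \<Union> (hull_of ` bisected N \<T> ?e) \<longleftrightarrow>
        (\<exists>C\<in>\<T> - patch \<T> ?e. x \<in> hull_of C) \<or> (\<exists>A\<in>patch \<T> ?e. \<exists>C\<in>children N A. x \<in> hull_of C)"
      by (simp add: bisected_def bex_Un)
    also have "\<dots> \<longleftrightarrow> (\<exists>C\<in>\<T> - patch \<T> ?e. x \<in> hull_of C) \<or> (\<exists>A\<in>patch \<T> ?e. x \<in> hull_of A)"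
      using h by (simp add: patch_def cong: conj_cong bex_cong)
    also have "\<dots> \<longleftrightarrow> x \<in> \<Union> (hull_of ` \<T>)" by (auto simp: patch_def)
    finally show "x \<in> \<Union> (hull_of ` bisected N \<T> ?e) \<longleftrightarrow> x \<in> \<Union> (hull_of ` \<T>)" .
  qed
  ultimately show ?case using step.IH by simp
qed

section \<open>Comparing a triangulation with its refinements\<close>

lemma BB_finite: "\<T> \<in> BB N \<T>0 \<Longrightarrow> finite \<T>" using BB_invariants by blast
lemma BB_node: "\<T> \<in> BB N \<T>0 \<Longrightarrow> T \<in> \<T> \<Longrightarrow> node T" using BB_invariants by blast
lemma BB_conform: "\<T> \<in> BB N \<T>0 \<Longrightarrow> conform \<T>" using BB_invariants by blast
lemma BB_cover: "\<T> \<in> BB N \<T>0 \<Longrightarrow> \<T>' \<in> BB N \<T>0 \<Longrightarrow> \<Union> (hull_of ` \<T>) = \<Union> (hull_of ` \<T>')"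
  by (simp add: BB_invariants)

lemma BB_negligible: "\<T> \<in> BB N \<T>0 \<Longrightarrow> A \<in> \<T> \<Longrightarrow> B \<in> \<T> \<Longrightarrow> A \<noteq> B \<Longrightarrow> negligible (hull_of A \<inter> hull_of B)"
  using conform_negligible node_good BB_node BB_conform by blast

lemma BB_hull_subset:
  assumes "\<T> \<in> BB N \<T>0" "A \<in> \<T>" "B \<in> \<T>" "hull_of A \<subseteq> hull_of B"
  shows "A = B"
proof (rule ccontr)
  assume "A \<noteq> B"
  then have "negligible (hull_of A \<inter> hull_of B)" by (rule BB_negligible[OF assms(1-3)])
  moreover have "hull_of A \<inter> hull_of B = hull_of A" using assms(4) by blast
  ultimately show False using good_not_negligible(2)[OF node_good[OF BB_node[OF assms(1,2)]]] by simp
qed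

lemma TT_node: "T \<in> TT N \<T>0 \<Longrightarrow> node T"
  using BB_node by (auto simp: TT_def)

text \<open>A simplex of \<open>\<X>\<close> not contained in \<open>A\<close> lies in another
  simplex of \<open>\<T>\<close> and meets \<open>A\<close> in a null set. The part of the interior
  of \<open>A\<close> missed by \<open>?U\<close> is thus open and negligible, hence empty; since
  \<open>?U\<close> is closed, it contains all of \<open>A\<close>.\<close>

lemma refines_cover:
  assumes "\<X> \<in> BB N \<T>0" "\<T> \<in> BB N \<T>0" "refines \<X> \<T>" "A \<in> \<T>"
  shows "hull_of A \<subseteq> \<Union> (hull_of ` {X \<in> \<X>. hull_of X \<subseteq> hull_of A})" (is "_ \<subseteq> ?U")
proof -
  have gA: "good N A" using assms BB_node node_good by blast
  have comp: "compact (hull_of X)" if "X \<in> \<X>" for X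
    unfolding hull_of_def using goodD(1)[OF node_good[OF BB_node[OF assms(1) that]]]
    by (intro finite_imp_compact_convex_hull) auto
  have clU: "closed ?U"
    using BB_finite[OF assms(1)] comp by (intro closed_Union) (auto intro: compact_imp_closed)
  have "interior (hull_of A) \<subseteq> ?U"
  proof (rule ccontr)
    let ?O = "interior (hull_of A) - ?U"
    assume "\<not> interior (hull_of A) \<subseteq> ?U"
    then have ne: "?O \<noteq> {}" and op: "open ?O" using clU by auto
    have "?O \<subseteq> (\<Union>X\<in>{X \<in> \<X>. \<not> hull_of X \<subseteq> hull_of A}. hull_of X \<inter> hull_of A)"
    proof
      fix x assume x: "x \<in> ?O"
      then have xA: "x \<in> hull_of A" using interior_subset by blast
      then have "x \<in> \<Union> (hull_of ` \<X>)" using BB_cover[OF assms(1,2)] assms(4) by blast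
      then show "x \<in> (\<Union>X\<in>{X \<in> \<X>. \<not> hull_of X \<subseteq> hull_of A}. hull_of X \<inter> hull_of A)" using x xA by blast
    qed
    moreover have "negligible (\<Union>X\<in>{X \<in> \<X>. \<not> hull_of X \<subseteq> hull_of A}. hull_of X \<inter> hull_of A)"
    proof (intro negligible_Union)
      show "finite ((\<lambda>X. hull_of X \<inter> hull_of A) ` {X \<in> \<X>. \<not> hull_of X \<subseteq> hull_of A})"
        using BB_finite[OF assms(1)] by auto
      fix Z assume "Z \<in> (\<lambda>X. hull_of X \<inter> hull_of A) ` {X \<in> \<X>. \<not> hull_of X \<subseteq> hull_of A}"
      then obtain X where X: "X \<in> \<X>" "\<not> hull_of X \<subseteq> hull_of A" "Z = hull_of X \<inter> hull_of A" by blast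
      obtain B where B: "B \<in> \<T>" "hull_of X \<subseteq> hull_of B" using X assms(3) by (auto simp: refines_def)
      then have "B \<noteq> A" using X by blast
      then have "negligible (hull_of B \<inter> hull_of A)" by (rule BB_negligible[OF assms(2) B(1) assms(4)])
      moreover have "Z \<subseteq> hull_of B \<inter> hull_of A" using B(2) X(3) by blast
      ultimately show "negligible Z" by (rule negligible_subset)
    qed
    ultimately have "negligible ?O" using negligible_subset by blast
    then show False using ne op open_not_negligible by blast
  qed
  then have "closure (interior (hull_of A)) \<subseteq> ?U" using clU closure_minimal by blast
  moreover have "closure (interior (hull_of A)) = closure (hull_of A)"
    using good_not_negligible[OF gA] by (intro convex_closure_interior) (auto simp: hull_of_def)
  ultimately show ?thesis using closure_subset by blast
qed

lemma refines_below:
  assumes "\<X> \<in> BB N \<T>0" "\<T> \<in> BB N \<T>0" "refines \<X> \<T>" "A \<in> \<T>"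
  obtains X where "X \<in> \<X>" "desc N A X"
proof -
  have "hull_of A \<noteq> {}"
    using good_not_negligible(1)[OF node_good[OF BB_node[OF assms(2,4)]]] interior_subset by blast
  then obtain X where "X \<in> \<X>" "hull_of X \<subseteq> hull_of A" using refines_cover[OF assms] by blast
  then show ?thesis using that hull_subset_imp_desc BB_node assms by blast
qed

end

section \<open>Replaying closure steps on a finer triangulation\<close>

context initial_mesh
begin

text \<open>Absence of hanging vertices, the form in which conformity is used below: the point lies
  in the hull of the common face, and by affine independence it is a vertex of that face.\<close>

lemma edge_in_neighbour:
  assumes "\<T> \<in> BB N \<T>0" "T \<in> \<T>" "S \<in> \<T>" "v \<in> T" "fst v \<in> hull_of S"
  shows "v \<in> S"
proof -
  have "fst v \<in> hull_of (T \<inter> S)"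
    using BB_conform[OF assms(1)] assms in_hull_of[OF assms(4)] unfolding conform_def by blast
  then have "v \<in> T \<inter> S"
    using vertex_in_hull_of[OF node_good[OF BB_node[OF assms(1,2)]], of "T \<inter> S" v] assms(4) by auto
  then show ?thesis by blast
qed

lemma edge_notin_child:
  assumes "node S" "C \<in> children N S" "hull_of X \<subseteq> hull_of C"
  shows "\<not> bse N S \<subseteq> X"
proof
  assume sub: "bse N S \<subseteq> X"
  note gS = node_good[OF assms(1)]
  obtain x y where xy: "bse N S = {x, y}" "x \<noteq> y" "C = insert (bsv N S) (S - {x})"
    using child_cases[OF N_pos gS assms(2)] .
  have "fst x \<in> hull_of C" using sub xy(1) in_hull_of[of x X] assms(3) by blast
  moreover have "fst x \<in> hull_of {x}" by (rule in_hull_of) simp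
  ultimately have "fst x \<in> hull_of ({x} - {x})"
    using hull_of_Int_child(1)[OF N_pos gS xy(1,2), of "{x}" "fst x"] xy bse_edge[OF N_pos gS xy(1,2)] by auto
  then show False by (simp add: hull_of_def)
qed

text \<open>The midpoint is an extreme point of the child, hence of every subset of the child that
  contains it.\<close>

lemma midpoint_in_descendant:
  assumes "node S" "C \<in> children N S" "desc N C X" "fst (bsv N S) \<in> hull_of X"
  shows "fst (bsv N S) \<in> fst ` X"
proof -
  let ?w = "fst (bsv N S)"
  have nC: "node C" using node_child assms by blast
  have "?w \<in> fst ` C" using children_props(8)[OF N_pos node_good[OF assms(1)] assms(2) dim] by blast
  then have "?w extreme_point_of hull_of C" unfolding hull_of_def
    using extreme_point_of_convex_hull_affine_independent goodD(4)[OF node_good[OF nC]] by blast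
  then have "?w extreme_point_of hull_of X"
    using hull_desc[OF nC assms(3)] assms(4) unfolding extreme_point_of_def by blast
  then show ?thesis unfolding hull_of_def by (rule extreme_point_of_convex_hull)
qed

lemma refines_child:
  assumes "\<X> \<in> BB N \<T>0" "\<T> \<in> BB N \<T>0" "S \<in> \<T>" "X \<in> \<X>" "hull_of X \<subseteq> hull_of S" "X \<noteq> S"
  obtains C where "C \<in> children N S" "desc N C X"
proof -
  have "desc N S X" by (rule hull_subset_imp_desc) (use BB_node assms in auto)
  then show ?thesis using desc_top assms(6) that by blast
qed

text \<open>Either no simplex of the patch survives in \<open>\<X>\<close>, and then
  \<open>\<X>\<close> already refines the bisected mesh; or all of them survive, the patches of
  \<open>\<X>\<close> and \<open>\<T>\<close> coincide, and the same bisection is carried out in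
  \<open>\<X>\<close>.\<close>

lemma join_base:
  assumes T: "\<T> \<in> BB N \<T>0" "T \<in> \<T>" and X: "\<X> \<in> BB N \<T>0" "refines \<X> \<T>"
    and e: "\<forall>T'\<in>patch \<T> (bse N T). bse N T' = bse N T"
  shows "\<exists>\<X>'\<in>BB N \<T>0. refines \<X>' \<X> \<and> refines \<X>' (bisected N \<T> (bse N T)) \<and>
    (\<forall>K X'. node K \<longrightarrow> X' \<in> \<X>' \<longrightarrow> desc N K X' \<longrightarrow> (\<exists>X\<in>\<X>. desc N K X) \<or> reach N (TT N \<T>0) T K)"
proof -
  let ?e = "bse N T" and ?P = "patch \<T> (bse N T)"
  have PT: "P \<in> \<T>" "?e \<subseteq> P" "bse N P = ?e" "node P" if "P \<in> ?P" for P
    using that e BB_node[OF T(1)] unfolding patch_def by blast+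
  have nT: "node T" using BB_node T by blast
  have TP: "T \<in> ?P" using T bse_subset[OF nT] by (simp add: patch_def)
  have strict: "\<exists>C\<in>children N P. desc N C S" if "P \<in> ?P" "S \<in> \<X>" "hull_of S \<subseteq> hull_of P" "S \<noteq> P" for P S
    using refines_child[OF X(1) T(1) PT(1)[OF that(1)] that(2-4)] by blast
  show ?thesis
  proof (cases "\<exists>P\<in>?P. P \<in> \<X>")
    case True
    then obtain P0 where P0: "P0 \<in> ?P" "P0 \<in> \<X>" by blast
    \<comment> \<open>If \<open>P0\<close> survives but \<open>P\<close> does not, some simplex of
      \<open>\<X>\<close> inside \<open>P\<close> has the midpoint of the common edge as a vertex.
      This point lies in \<open>P0\<close>, so it is a vertex of \<open>P0\<close> by conformity of
      \<open>\<X>\<close>, although a midpoint never is.\<close>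
    have all: "P \<in> \<X>" if P: "P \<in> ?P" for P
    proof (rule ccontr)
      assume nP: "P \<notin> \<X>"
      let ?w = "fst (bsv N P)"
      have w: "bsv N P0 = bsv N P"
        by (rule bsv_eq) (use N_pos PT[OF P] PT[OF P0(1)] node_good in auto)
      obtain a b where ab: "bse N P = {a, b}" "a \<noteq> b" using bse_cases[OF N_pos node_good[OF PT(4)[OF P]]] .
      obtain C0 where "C0 \<in> children N P" using bse_edge(5)[OF N_pos node_good[OF PT(4)[OF P]] ab] by blast
      then have "?w \<in> hull_of P"
        using children_props(6,8)[OF N_pos node_good[OF PT(4)[OF P]] _ dim] in_hull_of by blast
      then obtain S where S: "S \<in> \<X>" "hull_of S \<subseteq> hull_of P" "?w \<in> hull_of S"
        using refines_cover[OF X(1) T(1) X(2) PT(1)[OF P]] by blast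
      then obtain C where C: "C \<in> children N P" "desc N C S" using strict[OF P] nP by blast
      then have "?w \<in> fst ` S" using midpoint_in_descendant PT(4)[OF P] S(3) by blast
      then obtain v where v: "v \<in> S" "fst v = ?w" by (metis imageE)
      obtain C1 where C1: "C1 \<in> children N P0"
        using bse_edge(5)[OF N_pos node_good[OF PT(4)[OF P0(1)]]] ab PT(3)[OF P] PT(3)[OF P0(1)] by blast
      note cp = children_props[OF N_pos node_good[OF PT(4)[OF P0(1)]] C1 dim]
      have "?w \<in> hull_of P0" using in_hull_of[OF cp(8)] cp(6) w by auto
      then have "v \<in> P0" using edge_in_neighbour[OF X(1) S(1) P0(2) v(1)] v(2) by simp
      then have "fst (bsv N P0) \<in> fst ` P0" using v(2) w by (metis imageI)
      then show False
        using bse_edge(6)[OF N_pos node_good[OF PT(4)[OF P0(1)]]] ab PT(3)[OF P] PT(3)[OF P0(1)] by metis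
    qed
    \<comment> \<open>A simplex of \<open>\<X>\<close> containing the edge lies in some
      \<open>S0\<close> of the patch. If it were smaller, it would lie in a child of
      \<open>S0\<close>, which misses an endpoint of the edge.\<close>
    have inP: "S \<in> ?P" if S: "S \<in> \<X>" "?e \<subseteq> S" for S
    proof -
      obtain S0 where S0: "S0 \<in> \<T>" "hull_of S \<subseteq> hull_of S0" using X(2) S by (auto simp: refines_def)
      have "v \<in> S0" if "v \<in> ?e" for v
        by (rule edge_in_neighbour[OF T(1,2) S0(1)]) (use that bse_subset[OF nT] S S0 in_hull_of in blast)+
      then have P: "S0 \<in> ?P" using S0 by (auto simp: patch_def)
      have "S = S0"
      proof (rule ccontr)
        assume "S \<noteq> S0"
        then obtain C where C: "C \<in> children N S0" "desc N C S" using strict[OF P S(1) S0(2)] by blast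
        then have "hull_of S \<subseteq> hull_of C" using hull_desc node_child PT(4)[OF P] by blast
        then show False using edge_notin_child[OF PT(4)[OF P] C(1)] S(2) PT(3)[OF P] by simp
      qed
      then show ?thesis using P by simp
    qed
    have eq: "patch \<X> ?e = ?P"
    proof
      show "patch \<X> ?e \<subseteq> ?P"
      proof
        fix S assume "S \<in> patch \<X> ?e"
        then show "S \<in> ?P" unfolding patch_def[of \<X>] using inP by simp
      qed
      show "?P \<subseteq> patch \<X> ?e"
      proof
        fix P assume P: "P \<in> ?P"
        show "P \<in> patch \<X> ?e" unfolding patch_def[of \<X>] using all[OF P] PT(2)[OF P] by simp
      qed
    qed
    let ?X' = "bisected N \<X> ?e"
    have TX: "T \<in> \<X>" using all TP by blast
    have "refine1 N \<X> T ?X'" unfolding bisected_def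
      by (rule refine1.base[OF TX]) (unfold eq, rule e)
    then have BBX': "?X' \<in> BB N \<T>0" using BB.step X(1) TX by blast
    have cases: "S \<in> \<X> \<and> S \<notin> ?P \<or> (\<exists>P\<in>?P. S \<in> children N P)" if "S \<in> ?X'" for S
      using that unfolding bisected_def eq by blast
    have r1: "refines ?X' \<X>"
      unfolding refines_def
    proof
      fix S assume "S \<in> ?X'"
      from cases[OF this] show "\<exists>B\<in>\<X>. hull_of S \<subseteq> hull_of B"
      proof (elim disjE)
        assume "\<exists>P\<in>?P. S \<in> children N P"
        then obtain P where P: "P \<in> ?P" "S \<in> children N P" by blast
        then have "hull_of S \<subseteq> hull_of P" using children_props(6)[OF N_pos node_good _ dim] PT(4) by blast
        then show ?thesis using all P by blast
      qed blast
    qed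
    have r2: "refines ?X' (bisected N \<T> ?e)"
      unfolding refines_def
    proof
      fix S assume "S \<in> ?X'"
      from cases[OF this] show "\<exists>B\<in>bisected N \<T> ?e. hull_of S \<subseteq> hull_of B"
      proof (elim disjE)
        assume S: "S \<in> \<X> \<and> S \<notin> ?P"
        then obtain S0 where S0: "S0 \<in> \<T>" "hull_of S \<subseteq> hull_of S0" using X(2) by (auto simp: refines_def)
        have "S0 \<notin> ?P"
        proof
          assume P: "S0 \<in> ?P"
          then have "S = S0" using BB_hull_subset[OF X(1) _ all S0(2)] S by blast
          then show False using S P by blast
        qed
        then show ?thesis using S0 by (auto simp: bisected_def)
      next
        assume "\<exists>P\<in>?P. S \<in> children N P"
        then show ?thesis by (auto simp: bisected_def)
      qed
    qed
    have r3: "(\<exists>X\<in>\<X>. desc N K X) \<or> reach N (TT N \<T>0) T K" if "node K" "X' \<in> ?X'" "desc N K X'" for K X'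
      using cases[OF that(2)]
    proof (elim disjE)
      assume "\<exists>P\<in>?P. X' \<in> children N P"
      then obtain P where P: "P \<in> ?P" "X' \<in> children N P" by blast
      have "reach N (TT N \<T>0) T X'"
        by (rule reach_base[of _ _ P]) (use PT[OF P(1)] P T in \<open>auto simp: TT_def\<close>)
      moreover have "K = X' \<or> desc N K P" using desc_child[OF PT(4)[OF P(1)] P(2) that(1,3)] .
      ultimately show ?thesis using all P by blast
    qed (use that in blast)
    show ?thesis using BBX' r1 r2 r3 by blast
  next
    case False
    have "refines \<X> (bisected N \<T> ?e)" unfolding refines_def
    proof
      fix S assume S: "S \<in> \<X>"
      then obtain S0 where S0: "S0 \<in> \<T>" "hull_of S \<subseteq> hull_of S0" using X(2) by (auto simp: refines_def)
      show "\<exists>B\<in>bisected N \<T> ?e. hull_of S \<subseteq> hull_of B"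
      proof (cases "S0 \<in> ?P")
        case P: True
        then have "S \<noteq> S0" using S False by blast
        then obtain C where C: "C \<in> children N S0" "desc N C S" using strict[OF P S S0(2)] by blast
        then have "hull_of S \<subseteq> hull_of C" using hull_desc node_child PT(4)[OF P] by blast
        then show ?thesis using C P by (auto simp: bisected_def)
      next
        case False
        then show ?thesis using S0 by (auto simp: bisected_def)
      qed
    qed
    then show ?thesis using X refines_refl by blast
  qed
qed

text \<open>In the recursive case two replays are composed, and what the call at \<open>T'\<close>
  creates counts as reached from \<open>T\<close>. The calls work on different meshes, which is why
  \<open>reach\<close> takes its simplices from all of \<open>TT\<close>.\<close>

lemma join_refine1:
  assumes "refine1 N \<T> T \<T>2" "\<T> \<in> BB N \<T>0" "\<X> \<in> BB N \<T>0" "refines \<X> \<T>"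
  shows "\<exists>\<X>'\<in>BB N \<T>0. refines \<X>' \<X> \<and> refines \<X>' \<T>2 \<and>
    (\<forall>K X'. node K \<longrightarrow> X' \<in> \<X>' \<longrightarrow> desc N K X' \<longrightarrow> (\<exists>X\<in>\<X>. desc N K X) \<or> reach N (TT N \<T>0) T K)"
  using assms
proof (induction arbitrary: \<X> rule: refine1.induct)
  case (base T \<T>)
  then show ?case using join_base[of \<T> T \<X>] by (simp add: bisected_def)
next
  case (recur T \<T> T' \<T>1 \<T>2)
  have T': "T' \<in> \<T>" "bse N T \<subseteq> T'" using recur by (auto simp: patch_def)
  have T1: "\<T>1 \<in> BB N \<T>0" using BB.step recur T' by blast
  obtain \<X>1 where X1: "\<X>1 \<in> BB N \<T>0" "refines \<X>1 \<X>" "refines \<X>1 \<T>1"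
    "\<And>K X'. node K \<Longrightarrow> X' \<in> \<X>1 \<Longrightarrow> desc N K X' \<Longrightarrow> (\<exists>X\<in>\<X>. desc N K X) \<or> reach N (TT N \<T>0) T' K"
    using recur.IH(1)[OF recur.prems] by blast
  obtain \<X>2 where X2: "\<X>2 \<in> BB N \<T>0" "refines \<X>2 \<X>1" "refines \<X>2 \<T>2"
    "\<And>K X'. node K \<Longrightarrow> X' \<in> \<X>2 \<Longrightarrow> desc N K X' \<Longrightarrow> (\<exists>X\<in>\<X>1. desc N K X) \<or> reach N (TT N \<T>0) T K"
    using recur.IH(2)[OF T1 X1(1,3)] by blast
  have "reach N (TT N \<T>0) T K" if "reach N (TT N \<T>0) T' K" for K
    by (rule reach_step[OF _ _ T'(2) recur(3) that]) (use recur(1,5,7) recur.prems(1) T' in \<open>auto simp: TT_def\<close>)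
  then have "(\<exists>X\<in>\<X>. desc N K X) \<or> reach N (TT N \<T>0) T K"
    if "node K" "X' \<in> \<X>2" "desc N K X'" for K X'
    using X1(4) X2(4) that by blast
  then show ?case using X2(1,3) refines_trans[OF X2(2) X1(2)] by blast
qed

lemma join_marked:
  assumes "finite \<M>" "\<T> \<in> BB N \<T>0" "\<And>M. M \<in> \<M> \<Longrightarrow> refine1 N \<T> M (R M)"
  shows "\<exists>\<X>\<in>BB N \<T>0. refines \<X> \<T> \<and> (\<forall>M\<in>\<M>. refines \<X> (R M)) \<and>
    (\<forall>K X. node K \<longrightarrow> X \<in> \<X> \<longrightarrow> desc N K X \<longrightarrow> (\<exists>X\<in>\<T>. desc N K X) \<or> (\<exists>M\<in>\<M>. reach N (TT N \<T>0) M K))"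
  using assms(1,3)
proof (induction rule: finite_induct)
  case empty
  then show ?case using assms(2) refines_refl by blast
next
  case (insert M \<F>)
  obtain \<X> where X: "\<X> \<in> BB N \<T>0" "refines \<X> \<T>" "\<And>M. M \<in> \<F> \<Longrightarrow> refines \<X> (R M)"
    "\<And>K X. node K \<Longrightarrow> X \<in> \<X> \<Longrightarrow> desc N K X \<Longrightarrow> (\<exists>X\<in>\<T>. desc N K X) \<or> (\<exists>M\<in>\<F>. reach N (TT N \<T>0) M K)"
    using insert.IH insert.prems by blast
  have RM: "refine1 N \<T> M (R M)" using insert.prems by simp
  obtain \<X>' where X': "\<X>' \<in> BB N \<T>0" "refines \<X>' \<X>" "refines \<X>' (R M)"
    "\<And>K X'. node K \<Longrightarrow> X' \<in> \<X>' \<Longrightarrow> desc N K X' \<Longrightarrow> (\<exists>X\<in>\<X>. desc N K X) \<or> reach N (TT N \<T>0) M K"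
    using join_refine1[OF RM assms(2) X(1,2)] by blast
  show ?case
  proof (intro bexI[OF _ X'(1)] conjI ballI allI impI)
    show "refines \<X>' \<T>" using refines_trans[OF X'(2) X(2)] .
    show "refines \<X>' (R M')" if "M' \<in> insert M \<F>" for M'
      using that X'(3) refines_trans[OF X'(2) X(3)] by blast
    show "(\<exists>X\<in>\<T>. desc N K X) \<or> (\<exists>M\<in>insert M \<F>. reach N (TT N \<T>0) M K)"
      if "node K" "X \<in> \<X>'" "desc N K X" for K X
      using X'(4)[OF that] X(4) that(1) by blast
  qed
qed

text \<open>By coarseness the mesh from \<open>join_marked\<close> refines \<open>\<T>'\<close>, so
  it contains a descendant of \<open>K\<close>. Were \<open>K\<close> also an ancestor of some
  \<open>A\<close> in \<open>\<T>\<close>, it would be squeezed between \<open>A\<close> and the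
  simplex of \<open>\<T>\<close> containing \<open>K\<close>; these would coincide and
  \<open>K\<close> would lie in \<open>\<T>\<close>.\<close>

lemma refine_marked_reach:
  assumes T: "\<T> \<in> BB N \<T>0" and M: "\<M> \<subseteq> \<T>" and r: "refine_marked N \<T>0 \<T> \<M> \<T>'"
    and K: "K \<in> \<T>'" "K \<notin> \<T>"
  shows "\<exists>M\<in>\<M>. reach N (TT N \<T>0) M K"
proof -
  obtain R where R: "\<And>M. M \<in> \<M> \<Longrightarrow> refine1 N \<T> M (R M)" and T': "\<T>' \<in> BB N \<T>0" "refines \<T>' \<T>"
    and coarse: "\<And>\<X>. \<X> \<in> BB N \<T>0 \<Longrightarrow> refines \<X> \<T> \<Longrightarrow> \<forall>M\<in>\<M>. refines \<X> (R M) \<Longrightarrow> refines \<X> \<T>'"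
    using r unfolding refine_marked_def by blast
  have "finite \<M>" using M BB_finite[OF T] finite_subset by blast
  then obtain \<X> where X: "\<X> \<in> BB N \<T>0" "refines \<X> \<T>" "\<forall>M\<in>\<M>. refines \<X> (R M)"
    "\<And>K X. node K \<Longrightarrow> X \<in> \<X> \<Longrightarrow> desc N K X \<Longrightarrow> (\<exists>X\<in>\<T>. desc N K X) \<or> (\<exists>M\<in>\<M>. reach N (TT N \<T>0) M K)"
    using join_marked[OF _ T R] by blast
  have nK: "node K" using BB_node T' K by blast
  have "refines \<X> \<T>'" using coarse X by blast
  then obtain S where S: "S \<in> \<X>" "desc N K S" using refines_below[OF X(1) T'(1) _ K(1)] by blast
  have "\<not> (\<exists>A\<in>\<T>. desc N K A)"
  proof
    assume "\<exists>A\<in>\<T>. desc N K A"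
    then obtain A where A: "A \<in> \<T>" "desc N K A" by blast
    obtain B where B: "B \<in> \<T>" "hull_of K \<subseteq> hull_of B" using T'(2) K by (auto simp: refines_def)
    have AK: "hull_of A \<subseteq> hull_of K" using hull_desc nK A by blast
    have "A = B" by (rule BB_hull_subset[OF T A(1) B(1)]) (use AK B in blast)
    then have "K = A" using node_hull_eq[OF nK A(2)] B by blast
    then show False using A K by blast
  qed
  then show ?thesis using X(4)[OF nK S] by blast
qed

end

section \<open>Distances and volumes\<close>

text \<open>Bernoulli's inequality gives (1 - 1/(2N))^N >= 1/2. Hence 1 / (1 - 2^(-1/N)) <= 2N, the
  sum of the geometric series behind \<open>pot\<close>.\<close>

lemma two_powr_step:
  assumes "N > 0"
  shows "2 powr (- 1 / real N) \<le> 1 - 1 / (2 * real N)"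
proof -
  let ?q = "2 powr (- 1 / real N)" and ?x = "1 - 1 / (2 * real N)"
  have "?q ^ N = 2 powr (- 1)" using assms by (simp add: powr_power)
  then have q: "?q ^ N = 1 / 2" by (simp add: powr_minus)
  have "1 + real N * (- 1 / (2 * real N)) \<le> (1 + (- 1 / (2 * real N))) ^ N"
    by (rule Bernoulli_inequality) (use assms in \<open>simp add: field_simps\<close>)
  then have "1 / 2 \<le> ?x ^ N" using assms by simp
  then have "?q ^ N \<le> ?x ^ N" by (simp only: q)
  moreover have "0 \<le> ?x" using assms by (simp add: field_simps)
  moreover have "0 \<le> ?q" by simp
  ultimately show ?thesis using power_mono_iff[of ?q ?x N] assms by blast
qed

lemma real_lev_bounds:
  assumes "N > 0"
  shows "real_of_int g / real N \<le> real_of_int (lev N g)" "real_of_int (lev N g) \<le> real_of_int g / real N + 1"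
proof -
  have "g \<le> int N * lev N g" "int N * (lev N g - 1) \<le> g"
    using lev_vtype[OF assms, of g] vtype_bounds[OF assms, of g] by (auto simp: algebra_simps)
  then have "real_of_int g \<le> real_of_int (int N * lev N g)" "real_of_int (int N * (lev N g - 1)) \<le> real_of_int g"
    by (simp_all only: of_int_le_iff)
  then show "real_of_int g / real N \<le> real_of_int (lev N g)" "real_of_int (lev N g) \<le> real_of_int g / real N + 1"
    using assms by (auto simp: field_simps)
qed

definition msize :: "nat \<Rightarrow> 'a splx \<Rightarrow> real" where
  "msize N S = 2 powr (- real_of_int (lev_s N S))"

lemma msize_pos: "0 < msize N S" by (simp add: msize_def)

text \<open>\<open>c0\<close> carries the volume information; for a colored triangulation it is
  obtained from the lower diameter bound at level 0 and the shape regularity.\<close>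

locale scaled_mesh = initial_mesh +
  fixes d D c0 :: real
  assumes d_pos: "0 < d" and d_le_D: "d \<le> D"
    and diam_le: "\<And>T. T \<in> TT N \<T>0 \<Longrightarrow> diameter (hull_of T) \<le> D * msize N T"
    and c0_pos: "0 < c0" and vol_init: "\<And>T. T \<in> \<T>0 \<Longrightarrow> c0 \<le> vol T"
begin

lemma D_pos: "0 < D" using d_pos d_le_D by simp

lemma node_lev_nonneg:
  assumes "node T" shows "0 \<le> lev_s N T"
proof -
  obtain R where R: "R \<in> \<T>0" "desc N R T" using assms by (auto simp: node_def)
  show ?thesis
  proof (cases "R = T")
    case True then show ?thesis using lev_init R by force
  next
    case False
    have gR: "good N R" using good_init R by blast
    have "gmax R \<le> bgen N R" unfolding gmax_def
      using goodD[OF gR] by (intro Max.boundedI) (auto intro: less_imp_le)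
    also have "bgen N R \<le> gmax T" using desc_props[OF R(2) N_pos gR dim] False by blast
    finally have "lev N (gmax R) \<le> lev N (gmax T)" using lev_mono N_pos by blast
    then show ?thesis using lev_init[OF R(1)] lev_s_gmax[OF N_pos goodD(1,8)[OF gR]]
        lev_s_gmax[OF N_pos goodD(1,8)[OF node_good[OF assms]]] by linarith
  qed
qed

lemma node_vol:
  assumes "node T" shows "c0 * msize N T ^ DIM('a) \<le> vol T"
proof -
  obtain R where R: "R \<in> \<T>0" "desc N R T" using assms by (auto simp: node_def)
  have gR: "good N R" using good_init R by blast
  let ?k = "nat (psi N T - psi N R)" and ?l = "lev_s N T"
  have "real_of_int (psi N T - psi N R) \<le> real_of_int (int DIM('a) * ?l)"
    using psi_le[OF N_pos node_good[OF assms]] psi_init[OF R(1)] by linarith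
  moreover have "0 \<le> psi N T - psi N R" using desc_props[OF R(2) N_pos gR dim] by simp
  ultimately have "real ?k \<le> real DIM('a) * real_of_int ?l" by simp
  then have "2 powr real ?k \<le> 2 powr (real DIM('a) * real_of_int ?l)" by simp
  then have "2 ^ ?k * msize N T ^ DIM('a) \<le> 2 powr (real DIM('a) * real_of_int ?l) * msize N T ^ DIM('a)"
    using msize_pos[of N T] by (simp add: powr_realpow)
  also have "\<dots> = 1" by (simp add: msize_def powr_power powr_add[symmetric] mult.commute)
  finally have k: "2 ^ ?k * msize N T ^ DIM('a) \<le> 1" .
  have "c0 * msize N T ^ DIM('a) \<le> (2 ^ ?k * vol T) * msize N T ^ DIM('a)"
    using vol_init[OF R(1)] desc_props[OF R(2) N_pos gR dim] msize_pos[of N T]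
    by (intro mult_right_mono) auto
  also have "\<dots> = vol T * (2 ^ ?k * msize N T ^ DIM('a))" by simp
  also have "\<dots> \<le> vol T * 1" using k by (intro mult_left_mono) (auto simp: vol_def)
  finally show ?thesis by simp
qed

section \<open>Distance covered by a recursion\<close>

lemma hull_compact: "node T \<Longrightarrow> compact (hull_of T)"
  unfolding hull_of_def using goodD(1)[OF node_good] by (intro finite_imp_compact_convex_hull) auto

lemma hull_dist:
  assumes "T \<in> TT N \<T>0" "x \<in> hull_of T" "y \<in> hull_of T"
  shows "dist x y \<le> D * msize N T"
  using diameter_bounded_bound[OF compact_imp_bounded[OF hull_compact[OF TT_node[OF assms(1)]]] assms(2,3)]
    diam_le[OF assms(1)] by linarith

text \<open>A bound for the sum of 2 D 2^(-h/N) over all generations h >= g: the series has the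
  value 2 D 2^(-g/N) / (1 - 2^(-1/N)), and the denominator costs a factor 2N.\<close>

definition pot :: "int \<Rightarrow> real" where
  "pot g = 4 * real N * D * 2 powr (- real_of_int g / real N)"

lemma pot_antimono: "g \<le> h \<Longrightarrow> pot h \<le> pot g"
  unfolding pot_def using D_pos N_pos by (intro mult_left_mono) (auto simp: divide_right_mono)

text \<open>The left side bounds the diameter of a simplex whose bisection vertex has generation
  \<open>g\<close>, because its level is at least \<open>lev N g - 1\<close>.\<close>

lemma pot_step: "D * 2 powr (1 - real_of_int (lev N g)) \<le> pot g - pot (g + 1)"
proof -
  let ?p = "2 powr (- real_of_int g / real N)"
  have "1 - real_of_int (lev N g) \<le> 1 + (- real_of_int g / real N)" using real_lev_bounds[OF N_pos, of g] by simp
  then have "2 powr (1 - real_of_int (lev N g)) \<le> 2 powr (1 + (- real_of_int g / real N))" by simp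
  also have "\<dots> = 2 * ?p" by (subst powr_add) simp
  finally have 1: "D * 2 powr (1 - real_of_int (lev N g)) \<le> D * (2 * ?p)"
    using D_pos by (intro mult_left_mono) auto
  have "- real_of_int (g + 1) / real N = - real_of_int g / real N + (- 1 / real N)"
    using N_pos by (simp add: field_simps)
  then have e: "2 powr (- real_of_int (g + 1) / real N) = ?p * 2 powr (- 1 / real N)" by (simp only: powr_add)
  have "1 \<le> 2 * real N * (1 - 2 powr (- 1 / real N))"
    using two_powr_step[OF N_pos] N_pos by (simp add: field_simps)
  then have "(2 * D * ?p) * 1 \<le> (2 * D * ?p) * (2 * real N * (1 - 2 powr (- 1 / real N)))"
    using D_pos by (intro mult_left_mono) auto
  also have "\<dots> = pot g - pot (g + 1)" unfolding pot_def e by (simp add: algebra_simps)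
  finally show ?thesis using 1 by simp
qed

text \<open>Passing from g/N to the level costs at most 1 in the exponent, which turns the 4 of
  \<open>pot\<close> into 8.\<close>

lemma pot_le: "pot g \<le> 8 * real N * D * 2 powr (- real_of_int (lev N g))"
proof -
  have "- real_of_int g / real N \<le> 1 + (- real_of_int (lev N g))" using real_lev_bounds[OF N_pos, of g] by simp
  then have "2 powr (- real_of_int g / real N) \<le> 2 powr (1 + (- real_of_int (lev N g)))" by simp
  also have "\<dots> = 2 * 2 powr (- real_of_int (lev N g))" by (subst powr_add) simp
  finally have "4 * real N * D * 2 powr (- real_of_int g / real N) \<le>
      4 * real N * D * (2 * 2 powr (- real_of_int (lev N g)))"
    using D_pos by (intro mult_left_mono) auto
  then show ?thesis unfolding pot_def by simp
qed

text \<open>Along a chain of recursive calls the generations of the bisection vertices decrease strictly,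
  so the diameters met on the way are summed by the telescoping potential \<open>pot\<close>.\<close>
lemma reach_pot:
  assumes "reach N (TT N \<T>0) M K"
  shows "gmax K \<le> bgen N M \<and> (\<exists>x\<in>hull_of K. \<exists>y\<in>hull_of M. dist x y \<le> pot (gmax K) - pot (bgen N M))"
  using assms
proof (induction rule: reach.induct)
  case (reach_base T T' C)
  have n: "node T" "node T'" using reach_base TT_node by auto
  have w: "bsv N T' = bsv N T" by (rule bsv_eq) (use N_pos n node_good reach_base(4) in auto)
  note cp = children_props[OF N_pos node_good[OF n(2)] reach_base(5) dim]
  obtain a b where ab: "bse N T = {a, b}" "a \<noteq> b" using bse_cases[OF N_pos node_good[OF n(1)]] .
  obtain C1 where C1: "C1 \<in> children N T" using bse_edge(5)[OF N_pos node_good[OF n(1)] ab] by blast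
  note cp1 = children_props[OF N_pos node_good[OF n(1)] C1 dim]
  have "fst (bsv N T) \<in> hull_of T" using in_hull_of[OF cp1(8)] cp1(6) by auto
  moreover have "fst (bsv N T) \<in> hull_of C" using in_hull_of[OF cp(8)] w by simp
  moreover have "gmax C = bgen N T" using cp(3) w by (simp add: bgen_def)
  ultimately show ?case by (intro conjI bexI[of _ "fst (bsv N T)"]) auto
next
  case (reach_step T T' K)
  have n: "node T" "node T'" using reach_step TT_node by auto
  have lt: "bgen N T' < bgen N T"
    by (rule bgen_less_edge) (use N_pos n node_good reach_step in auto)
  obtain x y where xy: "x \<in> hull_of K" "y \<in> hull_of T'" "dist x y \<le> pot (gmax K) - pot (bgen N T')"
    and le: "gmax K \<le> bgen N T'" using reach_step by blast
  obtain a b where ab: "bse N T = {a, b}" "a \<noteq> b" using bse_cases[OF N_pos node_good[OF n(1)]] .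
  \<comment> \<open>The bisection edge of \<open>T\<close> belongs to both simplices, so its
    endpoint connects them, and the step costs only the diameter of \<open>T'\<close>.\<close>
  have z: "fst a \<in> hull_of T" "fst a \<in> hull_of T'"
    using in_hull_of[of a T] in_hull_of[of a T'] bse_edge(1)[OF N_pos node_good[OF n(1)] ab] ab reach_step(3)
    by auto
  have "dist y (fst a) \<le> D * msize N T'" using hull_dist[OF reach_step(2) xy(2) z(2)] .
  also have "\<dots> \<le> D * 2 powr (1 - real_of_int (lev N (bgen N T')))"
    using lev_bgen_le[OF N_pos node_good[OF n(2)]] D_pos by (simp add: msize_def)
  also have "\<dots> \<le> pot (bgen N T') - pot (bgen N T' + 1)" by (rule pot_step)
  also have "\<dots> \<le> pot (bgen N T') - pot (bgen N T)" using pot_antimono[of "bgen N T' + 1" "bgen N T"] lt by simp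
  finally have "dist x (fst a) \<le> pot (gmax K) - pot (bgen N T)" using xy(3) dist_triangle[of x "fst a" y] by linarith
  then show ?case using le lt xy z by (intro conjI bexI[of _ x] bexI[of _ "fst a"]) auto
qed

lemma reach_near:
  assumes "reach N (TT N \<T>0) M K" "node M" "node K"
  shows "lev_s N K \<le> lev_s N M + 1"
    "\<exists>x\<in>hull_of K. \<exists>y\<in>hull_of M. dist x y \<le> 8 * real N * D * msize N K"
proof -
  have lK: "lev_s N K = lev N (gmax K)" using lev_s_gmax[OF N_pos] goodD[OF node_good[OF assms(3)]] by simp
  obtain x y where r: "gmax K \<le> bgen N M" "x \<in> hull_of K" "y \<in> hull_of M" "dist x y \<le> pot (gmax K) - pot (bgen N M)"
    using reach_pot[OF assms(1)] by blast
  show "lev_s N K \<le> lev_s N M + 1"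
    using lev_mono[OF N_pos r(1)] lev_bgen_le[OF N_pos node_good[OF assms(2)]] lK by linarith
  have "0 \<le> pot (bgen N M)" unfolding pot_def using D_pos by simp
  then have "dist x y \<le> 8 * real N * D * msize N K" using r(4) pot_le[of "gmax K"] lK by (simp add: msize_def)
  then show "\<exists>x\<in>hull_of K. \<exists>y\<in>hull_of M. dist x y \<le> 8 * real N * D * msize N K" using r by blast
qed

text \<open>A packing argument: the simplices do not overlap and have volume at least c0 2^(-nk)
  each. The radius is given in units of 2^(-k), so the scale cancels and the bound does not depend
  on \<open>k\<close>.\<close>

lemma card_level_ball:
  assumes T: "\<T> \<in> BB N \<T>0" and \<F>: "\<F> \<subseteq> \<T>" "\<And>T. T \<in> \<F> \<Longrightarrow> lev_s N T = k"
    "\<And>T. T \<in> \<F> \<Longrightarrow> hull_of T \<subseteq> cball y (r * 2 powr (- real_of_int k))" and r: "0 \<le> r"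
  shows "real (card \<F>) \<le> unit_ball_vol (real DIM('a)) * r ^ DIM('a) / c0"
proof -
  let ?s = "2 powr (- real_of_int k)"
  have fin: "finite \<F>" using finite_subset \<F>(1) BB_finite[OF T] by blast
  have nF: "node T" if "T \<in> \<F>" for T using BB_node[OF T] \<F>(1) that by blast
  have meas: "hull_of T \<in> lmeasurable" if "T \<in> \<F>" for T using hull_compact[OF nF[OF that]] lmeasurable_compact by blast
  have "real (card \<F>) * (c0 * ?s ^ DIM('a)) = (\<Sum>T\<in>\<F>. c0 * ?s ^ DIM('a))" by simp
  also have "\<dots> \<le> (\<Sum>T\<in>\<F>. vol T)"
    using node_vol[OF nF] \<F>(2) by (intro sum_mono) (simp add: msize_def)
  also have "\<dots> = measure lebesgue (\<Union>T\<in>\<F>. hull_of T)" unfolding vol_def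
  proof (rule measure_negligible_finite_Union_image[symmetric, OF fin])
    show "pairwise (\<lambda>S T. negligible (hull_of S \<inter> hull_of T)) \<F>"
      unfolding pairwise_def using BB_negligible[OF T] \<F>(1) by blast
  qed (use meas in auto)
  also have "\<dots> \<le> measure lebesgue (cball y (r * ?s))"
  proof (rule measure_mono_fmeasurable)
    show "(\<Union>T\<in>\<F>. hull_of T) \<subseteq> cball y (r * ?s)" using \<F>(3) by blast
    show "(\<Union>T\<in>\<F>. hull_of T) \<in> sets lebesgue" using fin meas fmeasurableD by (intro sets.finite_UN) auto
  qed simp
  also have "\<dots> = unit_ball_vol (real DIM('a)) * (r * ?s) ^ DIM('a)" using r by (simp add: content_cball)
  also have "\<dots> = unit_ball_vol (real DIM('a)) * r ^ DIM('a) * ?s ^ DIM('a)" by (simp add: power_mult_distrib)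
  finally have "(real (card \<F>) * c0) * ?s ^ DIM('a) \<le> (unit_ball_vol (real DIM('a)) * r ^ DIM('a)) * ?s ^ DIM('a)"
    by (simp add: mult.assoc)
  moreover have "0 < ?s ^ DIM('a)" by simp
  ultimately have "real (card \<F>) * c0 \<le> unit_ball_vol (real DIM('a)) * r ^ DIM('a)"
    using mult_le_cancel_right_pos by blast
  then show ?thesis using c0_pos by (simp add: field_simps)
qed

end

section \<open>Charging new simplices to marked ones\<close>

lemma sum_two_powr_le: "(\<Sum>k\<in>{0..int n}. 2 powr real_of_int k) \<le> 2 * 2 powr real n"
proof (induction n)
  case (Suc n)
  have "{0..int (Suc n)} = insert (int (Suc n)) {0..int n}" by auto
  then have "(\<Sum>k\<in>{0..int (Suc n)}. 2 powr real_of_int k) = 2 powr real (Suc n) + (\<Sum>k\<in>{0..int n}. 2 powr real_of_int k)"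
    by simp
  also have "\<dots> \<le> 2 powr real (Suc n) + 2 * 2 powr real n" using Suc by simp
  also have "2 * 2 powr real n = 2 powr real (Suc n)" by (simp add: powr_add)
  finally show ?case by simp
qed simp

lemma sum_level_weights_le:
  assumes "0 \<le> m"
  shows "(\<Sum>k\<in>{0..m + 1}. 2 powr (real_of_int k - real_of_int m)) \<le> 4"
proof -
  have "(\<Sum>k\<in>{0..m + 1}. 2 powr (real_of_int k - real_of_int m)) =
      (\<Sum>k\<in>{0..m + 1}. 2 powr real_of_int k) * 2 powr (- real_of_int m)"
    unfolding sum_distrib_right by (intro sum.cong refl) (simp add: powr_add[symmetric])
  also have "\<dots> \<le> (2 * 2 powr (real_of_int m + 1)) * 2 powr (- real_of_int m)"
    using sum_two_powr_le[of "nat (m + 1)"] assms by (intro mult_right_mono) auto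
  also have "\<dots> = 2 * 2 powr (real_of_int m + 1 + - real_of_int m)" by (simp only: powr_add mult.assoc)
  also have "\<dots> = 4" by simp
  finally show ?thesis .
qed

locale adaptive_loop = scaled_mesh +
  fixes Ts Ms :: "nat \<Rightarrow> 'a splx set"
  assumes Ts_0: "Ts 0 = \<T>0" and marked: "\<And>l. Ms l \<subseteq> Ts l"
    and refined: "\<And>l. refine_marked N \<T>0 (Ts l) (Ms l) (Ts (Suc l))"
begin

lemma Ts_BB: "Ts l \<in> BB N \<T>0"
  by (cases l) (use Ts_0 BB.init refined in \<open>auto simp: refine_marked_def\<close>)

lemma Ms_finite: "finite (Ms l)"
  using marked BB_finite[OF Ts_BB] finite_subset by blast

lemma Ts_node: "T \<in> Ts l \<Longrightarrow> node T"
  using BB_node Ts_BB by blast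

lemma Ts_TT: "T \<in> Ts l \<Longrightarrow> T \<in> TT N \<T>0"
  using Ts_BB by (auto simp: TT_def)

lemma created_by_marked:
  assumes "K \<in> Ts l" "K \<notin> \<T>0"
  obtains l' M where "l' < l" "M \<in> Ms l'" "reach N (TT N \<T>0) M K"
proof -
  have "\<exists>l'<l. \<exists>M\<in>Ms l'. reach N (TT N \<T>0) M K" using assms(1)
  proof (induction l)
    case 0
    then show ?case using assms Ts_0 by simp
  next
    case (Suc l)
    show ?case
    proof (cases "K \<in> Ts l")
      case True
      then show ?thesis using Suc.IH less_Suc_eq by blast
    next
      case False
      then show ?thesis using refine_marked_reach[OF Ts_BB marked refined Suc.prems] by blast
    qed
  qed
  then show ?thesis using that by blast
qed

text \<open>The length of one link in units of the mesh size of \<open>K\<close>: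
  \<open>8 * real N * D\<close> from \<open>K\<close> to the marked simplex that created it, plus
  \<open>D\<close> for crossing \<open>K\<close>.\<close>

definition \<beta> :: real where "\<beta> = 8 * real N * D + D"

definition base_pt :: "'a splx \<Rightarrow> 'a" where "base_pt T = (SOME x. x \<in> hull_of T)"

text \<open>A mark is a pair of a step and a simplex. The sum over \<open>marks\<close> thus matches
  the sum of the cardinalities, and the links of a chain, which come from strictly decreasing steps,
  are distinct summands.\<close>

definition charge :: "'a splx \<Rightarrow> nat \<times> 'a splx \<Rightarrow> real" where
  "charge T = (\<lambda>(l, M). if lev_s N T - 1 \<le> lev_s N M \<and> (\<exists>z\<in>hull_of M. dist (base_pt T) z \<le> 2 * \<beta> * msize N T)
     then msize N M / msize N T else 0)"

definition marks :: "nat \<Rightarrow> (nat \<times> 'a splx) set" where "marks l = Sigma {..<l} Ms"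

lemma \<beta>_pos: "0 < \<beta>" using D_pos by (simp add: \<beta>_def add_nonneg_pos)

lemma base_pt: "node T \<Longrightarrow> base_pt T \<in> hull_of T"
  unfolding base_pt_def using good_not_negligible(1)[OF node_good] interior_subset
  by (metis all_not_in_conv someI_ex subset_empty)

lemma charge_nonneg: "0 \<le> charge T p"
  by (auto simp: charge_def msize_def split: prod.split)

lemma finite_marks: "finite (marks l)" using Ms_finite by (auto simp: marks_def)

text \<open>Follow the chain of marked simplices that caused \<open>T\<close>; \<open>s\<close> is the charge collected so far.
  As long as \<open>s < 1\<close> the chain has not moved further than \<open>2 * \<beta> * msize N T\<close> away from \<open>T\<close>.\<close>
lemma charge_chain:
  assumes T: "node T"
  shows "\<lbrakk>K \<in> Ts l; K \<notin> \<T>0; 0 \<le> s; s < 1; lev_s N T \<le> lev_s N K; y \<in> hull_of K;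
     dist (base_pt T) y \<le> \<beta> * msize N T * (1 + s) - \<beta> * msize N K\<rbrakk> \<Longrightarrow> 1 - s \<le> (\<Sum>p\<in>marks l. charge T p)"
proof (induction l arbitrary: K s y rule: less_induct)
  case (less l)
  obtain l' M where M: "l' < l" "M \<in> Ms l'" "reach N (TT N \<T>0) M K"
    using created_by_marked[OF less.prems(1,2)] .
  have MT: "M \<in> Ts l'" using M marked by blast
  note nM = Ts_node[OF MT] and nK = Ts_node[OF less.prems(1)]
  obtain x z where xz: "x \<in> hull_of K" "z \<in> hull_of M" "dist x z \<le> 8 * real N * D * msize N K"
    using reach_near(2)[OF M(3) nM nK] by blast
  have "dist y x \<le> D * msize N K" by (rule hull_dist[OF Ts_TT[OF less.prems(1)] less.prems(6) xz(1)])
  then have "dist y z \<le> \<beta> * msize N K" using xz(3) dist_triangle[of y z x] by (simp add: \<beta>_def algebra_simps)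
  then have dz: "dist (base_pt T) z \<le> \<beta> * msize N T * (1 + s)"
    using less.prems(7) dist_triangle[of "base_pt T" z y] by linarith
  also have "\<dots> \<le> \<beta> * msize N T * 2" using less.prems \<beta>_pos msize_pos[of N T] by (intro mult_left_mono) auto
  also have "\<dots> = 2 * \<beta> * msize N T" by (simp add: algebra_simps)
  finally have "dist (base_pt T) z \<le> 2 * \<beta> * msize N T" .
  moreover have "lev_s N T - 1 \<le> lev_s N M" using reach_near(1)[OF M(3) nM nK] less.prems(5) by simp
  ultimately have ch: "charge T (l', M) = msize N M / msize N T" using xz(2) by (auto simp: charge_def)
  let ?q = "msize N M / msize N T"
  have q: "0 < ?q" by (rule divide_pos_pos[OF msize_pos msize_pos])
  have inm: "(l', M) \<in> marks l" using M by (simp add: marks_def)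
  show ?case
  proof (cases "s + ?q < 1")
    case False
    have "charge T (l', M) \<le> (\<Sum>p\<in>marks l. charge T p)"
      by (rule member_le_sum[OF inm]) (auto simp: finite_marks charge_nonneg)
    then show ?thesis using False ch by simp
  next
    case True
    then have "?q < 1" using less.prems(3) by linarith
    then have "msize N M < msize N T" using msize_pos[of N T] by (simp add: divide_less_eq)
    then have lt: "lev_s N T < lev_s N M" by (simp add: msize_def)
    \<comment> \<open>With \<open>?q < 1\<close> the level of \<open>M\<close> exceeds that of
      \<open>T\<close>, hence 0. The chain cannot end in the initial mesh before a total charge of 1
      has been collected.\<close>
    then have "M \<notin> \<T>0" using lev_init node_lev_nonneg[OF T] by force
    \<comment> \<open>\<open>\<beta> * msize N T * ?q\<close> equals
      \<open>\<beta> * msize N M\<close>: the charge just collected is the distance allowance for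
      the next link.\<close>
    moreover have "\<beta> * msize N T * (1 + s) = \<beta> * msize N T * (1 + (s + ?q)) - \<beta> * msize N M"
      using msize_pos[of N T] by (simp add: field_simps)
    ultimately have IH: "1 - (s + ?q) \<le> (\<Sum>p\<in>marks l'. charge T p)"
      using less.IH[OF M(1) MT, of "s + ?q" z] less.prems(3) q True lt xz(2) dz by simp
    have nin: "(l', M) \<notin> marks l'" by (simp add: marks_def)
    have "insert (l', M) (marks l') \<subseteq> marks l" using inm M(1) by (auto simp: marks_def)
    then have "(\<Sum>p\<in>insert (l', M) (marks l'). charge T p) \<le> (\<Sum>p\<in>marks l. charge T p)"
      by (intro sum_mono2) (auto simp: finite_marks charge_nonneg)
    then show ?thesis using IH ch nin by (simp add: finite_marks)
  qed
qed

lemma charge_lower: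
  assumes "T \<in> Ts L" "T \<notin> \<T>0"
  shows "1 \<le> (\<Sum>p\<in>marks L. charge T p)"
  using charge_chain[OF Ts_node[OF assms(1)] assms, of 0 "base_pt T"] base_pt[OF Ts_node[OF assms(1)]] by simp

lemma charge_upper:
  assumes M: "node M" "M \<in> TT N \<T>0"
  shows "(\<Sum>T\<in>Ts L. charge T (l, M)) \<le> 4 * (unit_ball_vol (real DIM('a)) * (2 * \<beta> + 3 * D) ^ DIM('a) / c0)"
    (is "_ \<le> 4 * ?c")
proof -
  let ?m = "lev_s N M"
  define A where "A = {T \<in> Ts L. charge T (l, M) \<noteq> 0}"
  have finA: "finite A" using BB_finite[OF Ts_BB] by (simp add: A_def)
  obtain y where y: "y \<in> hull_of M" using base_pt[OF M(1)] by blast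
  have AE: "T \<in> Ts L" "node T" "lev_s N T - 1 \<le> ?m" "charge T (l, M) = 2 powr (real_of_int (lev_s N T) - real_of_int ?m)"
    "\<exists>z\<in>hull_of M. dist (base_pt T) z \<le> 2 * \<beta> * msize N T" if "T \<in> A" for T
  proof -
    show "T \<in> Ts L" using that by (simp add: A_def)
    then show "node T" by (rule Ts_node)
    show "lev_s N T - 1 \<le> ?m" "\<exists>z\<in>hull_of M. dist (base_pt T) z \<le> 2 * \<beta> * msize N T"
      using that by (auto simp: A_def charge_def split: if_splits)
    then have "charge T (l, M) = msize N M / msize N T" by (simp add: charge_def)
    then show "charge T (l, M) = 2 powr (real_of_int (lev_s N T) - real_of_int ?m)"
      by (simp add: msize_def powr_diff[symmetric])
  qed
  have cnt: "real (card {T \<in> A. lev_s N T = k}) \<le> ?c" for k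
  proof (rule card_level_ball[OF Ts_BB])
    show "{T \<in> A. lev_s N T = k} \<subseteq> Ts L" using AE(1) by blast
    show "0 \<le> 2 * \<beta> + 3 * D" using \<beta>_pos D_pos by simp
    fix T assume T: "T \<in> {T \<in> A. lev_s N T = k}"
    then have TA: "T \<in> A" and k: "lev_s N T = k" by auto
    then show "lev_s N T = k" by simp
    let ?s = "2 powr (- real_of_int k)"
    have sT: "msize N T = ?s" using k by (simp add: msize_def)
    have "- real_of_int ?m \<le> 1 + (- real_of_int k)" using AE(3)[OF TA] k by linarith
    then have "msize N M \<le> 2 powr (1 + (- real_of_int k))" by (simp add: msize_def)
    also have "\<dots> = 2 * ?s" by (subst powr_add) simp
    finally have sM: "msize N M \<le> 2 * ?s" .
    obtain z where z: "z \<in> hull_of M" "dist (base_pt T) z \<le> 2 * \<beta> * ?s" using AE(5)[OF TA] sT by auto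
    have "dist y z \<le> D * msize N M" using hull_dist[OF M(2) y z(1)] .
    also have "\<dots> \<le> D * (2 * ?s)" using sM D_pos by (intro mult_left_mono) auto
    finally have yz: "dist y z \<le> 2 * D * ?s" by simp
    \<comment> \<open>In units of \<open>?s\<close>: 2D from \<open>y\<close> to \<open>z\<close>
      within \<open>M\<close>, which may be one level coarser than \<open>T\<close>, then 2 \<beta>
      from \<open>z\<close> to the base point of \<open>T\<close>, and D within
      \<open>T\<close>.\<close>
    show "hull_of T \<subseteq> cball y ((2 * \<beta> + 3 * D) * ?s)"
    proof
      fix t assume t: "t \<in> hull_of T"
      have "dist (base_pt T) t \<le> D * ?s"
        using hull_dist[OF Ts_TT[OF AE(1)[OF TA]] base_pt[OF AE(2)[OF TA]] t] sT by simp
      moreover have "dist y t \<le> dist y z + dist (base_pt T) z + dist (base_pt T) t"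
        using dist_triangle[of y t z] dist_triangle[of z t "base_pt T"] by (simp add: dist_commute)
      ultimately have "dist y t \<le> 2 * D * ?s + 2 * \<beta> * ?s + D * ?s" using yz z(2) by linarith
      then show "t \<in> cball y ((2 * \<beta> + 3 * D) * ?s)" by (simp add: algebra_simps)
    qed
  qed
  have c: "0 \<le> ?c" using cnt[of 0] of_nat_0_le_iff order_trans by blast
  have "(\<Sum>T\<in>Ts L. charge T (l, M)) = (\<Sum>T\<in>A. charge T (l, M))"
    unfolding A_def using BB_finite[OF Ts_BB] by (intro sum.mono_neutral_right) auto
  also have "\<dots> = (\<Sum>k\<in>{0..?m + 1}. \<Sum>T\<in>{T \<in> A. lev_s N T = k}. charge T (l, M))"
  proof (rule sum.group[symmetric])
    show "lev_s N ` A \<subseteq> {0..?m + 1}" using AE(2,3) node_lev_nonneg by fastforce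
  qed (use finA in auto)
  also have "\<dots> = (\<Sum>k\<in>{0..?m + 1}. real (card {T \<in> A. lev_s N T = k}) * 2 powr (real_of_int k - real_of_int ?m))"
  proof (intro sum.cong refl)
    fix k
    have "(\<Sum>T\<in>{T \<in> A. lev_s N T = k}. charge T (l, M)) = (\<Sum>T\<in>{T \<in> A. lev_s N T = k}. 2 powr (real_of_int k - real_of_int ?m))"
      using AE(4) by (intro sum.cong) auto
    then show "(\<Sum>T\<in>{T \<in> A. lev_s N T = k}. charge T (l, M)) =
        real (card {T \<in> A. lev_s N T = k}) * 2 powr (real_of_int k - real_of_int ?m)" by simp
  qed
  also have "\<dots> \<le> (\<Sum>k\<in>{0..?m + 1}. ?c * 2 powr (real_of_int k - real_of_int ?m))"
    using cnt by (intro sum_mono mult_right_mono) auto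
  also have "\<dots> = ?c * (\<Sum>k\<in>{0..?m + 1}. 2 powr (real_of_int k - real_of_int ?m))" by (simp add: sum_distrib_left)
  also have "\<dots> \<le> ?c * 4" using sum_level_weights_le[OF node_lev_nonneg[OF M(1)]] c by (intro mult_left_mono)
  also have "?c * 4 = 4 * ?c" by (rule mult.commute)
  finally show ?thesis .
qed

lemma card_le_marked:
  "real (card (Ts L)) - real (card (Ts 0)) \<le>
    4 * (unit_ball_vol (real DIM('a)) * (2 * \<beta> + 3 * D) ^ DIM('a) / c0) * (\<Sum>l<L. real (card (Ms l)))"
    (is "_ \<le> 4 * ?c * _")
proof -
  have "card (Ts L) - card \<T>0 \<le> card (Ts L - \<T>0)" using finite_init by (rule diff_card_le_card_Diff)
  then have "real (card (Ts L)) - real (card (Ts 0)) \<le> (\<Sum>T\<in>Ts L - \<T>0. 1)" using Ts_0 by simp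
  also have "\<dots> \<le> (\<Sum>T\<in>Ts L - \<T>0. \<Sum>p\<in>marks L. charge T p)" using charge_lower by (intro sum_mono) auto
  also have "\<dots> \<le> (\<Sum>T\<in>Ts L. \<Sum>p\<in>marks L. charge T p)"
    using BB_finite[OF Ts_BB] charge_nonneg by (intro sum_mono2) (auto intro: sum_nonneg)
  also have "\<dots> = (\<Sum>p\<in>marks L. \<Sum>T\<in>Ts L. charge T p)" by (rule sum.swap)
  also have "\<dots> \<le> (\<Sum>p\<in>marks L. 4 * ?c)"
  proof (rule sum_mono)
    fix p assume "p \<in> marks L"
    then obtain l M where p: "p = (l, M)" "M \<in> Ms l" by (auto simp: marks_def)
    then have "M \<in> Ts l" using marked by blast
    then show "(\<Sum>T\<in>Ts L. charge T p) \<le> 4 * ?c" unfolding p(1) using charge_upper Ts_node Ts_TT by simp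
  qed
  also have "\<dots> = 4 * ?c * (\<Sum>l<L. real (card (Ms l)))" by (simp add: marks_def Ms_finite mult.commute)
  finally show ?thesis .
qed

end

section \<open>Initial triangulations\<close>

lemma hull_of_labelled: "hull_of ((\<lambda>p. (p, f p)) ` P) = convex hull P"
  by (simp add: hull_of_def image_image)

text \<open>Generation -N has level -1, while -N+1, ..., 0 have level 0. Generations are distinct,
  so at most the lowest vertex has level -1, and this is the one whose level \<open>psi\<close>
  drops.\<close>

lemma good_initial:
  fixes S :: "'a::euclidean_space splx"
  assumes N: "N > 0" and S: "finite S" "card S = DIM('a) + 1" "inj_on fst S" "\<not> affine_dependent (fst ` S)"
    "inj_on snd S" and b: "\<And>v. v \<in> S \<Longrightarrow> - int N \<le> snd v \<and> snd v \<le> 0"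
  shows "good N S" "lev_s N S = 0" "0 \<le> psi N S"
proof -
  have c2: "card S \<ge> 2" "S \<noteq> {}" using S(2) DIM_positive[where 'a='a] by (auto simp: Suc_leI)
  obtain x y where xy: "low_edge N S x y" "bgen N S = mid_gen N (snd x) (snd y)"
    using bisec_data_cases[OF N S(1,5) c2(1)] by metis
  have "0 < mid_gen N (snd x) (snd y)"
    using xy(1) b[of x] b[of y] vtype_bounds[OF N, of "snd x"] N by (auto simp: low_edge_def mid_gen_def)
  then have "snd v < bgen N S" if "v \<in> S" for v using b[OF that] xy(2) by simp
  then show "good N S" using S by (simp add: good_def)
  have lev0: "lev N g = 0" if "- int N < g" "g \<le> 0" for g
    by (rule lev_eqI[OF N]) (use that in auto)
  have "- int N < snd x" "x \<in> S" using xy(1) b[of y] by (auto simp: low_edge_def)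
  then have "- int N < gmax S" using S(1) unfolding gmax_def by (subst Max_gr_iff) auto
  moreover have "gmax S \<le> 0" unfolding gmax_def using S(1) c2 b by (subst Max_le_iff) auto
  ultimately show "lev_s N S = 0" using lev_s_gmax[OF N S(1) c2(2)] lev0 by simp
  let ?f = "\<lambda>v. lev N (snd v)"
  have "Min (?f ` S) \<in> ?f ` S" using S c2 by (intro Min_in) auto
  then obtain v where v: "v \<in> S" "Min (?f ` S) = ?f v" by auto
  have "?f u = 0" if u: "u \<in> S - {v}" for u
  proof (rule ccontr)
    assume ne: "?f u \<noteq> 0"
    then have gu: "snd u = - int N" using lev0[of "snd u"] b[of u] u by force
    have "snd v \<noteq> snd u" using S(5) v(1) u by (auto dest: inj_onD)
    then have "?f v = 0" using lev0[of "snd v"] b[OF v(1)] gu by simp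
    moreover have "?f v \<le> ?f u" using Min_le[of "?f ` S" "?f u"] v(2) S(1) u by simp
    moreover have "?f u \<le> ?f v" using lev_mono[OF N] gu b[OF v(1)] by simp
    ultimately show False using ne by simp
  qed
  then have "(\<Sum>u\<in>S - {v}. ?f u) = 0" by (simp add: sum.neutral)
  then show "0 \<le> psi N S" unfolding psi_def using v S(1) by (simp add: sum_diff1)
qed

lemma initial_labelled_mesh:
  fixes \<G> :: "'a::euclidean_space set set"
  assumes dim: "DIM('a) \<ge> 2" and N: "N \<ge> DIM('a)"
    and conf: "conforming_triangulation DIM('a) \<G> X" and col: "colored N \<G> c"
  shows "initial_mesh N (initial_labelled \<G> c)"
proof -
  let ?L = "\<lambda>P. (\<lambda>p. (p, - int (c p))) ` P"
  have N0: "N > 0" using dim N by simp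
  have P: "finite P" "card P = DIM('a) + 1" "\<not> affine_dependent P" "inj_on c P" "\<And>p. p \<in> P \<Longrightarrow> c p \<le> N"
    if "P \<in> \<G>" for P
    using conf col that by (auto simp: conforming_triangulation_def colored_def)
  have fstL: "fst ` ?L P = P" "inj_on fst (?L P)" for P by (auto simp: image_image inj_on_def)
  have props: "good N (?L P)" "lev_s N (?L P) = 0" "0 \<le> psi N (?L P)" if G: "P \<in> \<G>" for P
  proof -
    have "card (?L P) = DIM('a) + 1" using P(2)[OF G] by (subst card_image) (auto simp: inj_on_def)
    moreover have "inj_on snd (?L P)" using P(4)[OF G] by (auto simp: inj_on_def)
    moreover have "- int N \<le> snd v \<and> snd v \<le> 0" if "v \<in> ?L P" for v using that P(5)[OF G] by auto
    moreover have "finite (?L P)" "\<not> affine_dependent (fst ` ?L P)" using P(1,3)[OF G] fstL by simp_all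
    ultimately show "good N (?L P)" "lev_s N (?L P) = 0" "0 \<le> psi N (?L P)"
      using good_initial[OF N0, of "?L P"] fstL(2) by blast+
  qed
  have "conform (initial_labelled \<G> c)" unfolding conform_def initial_labelled_def
  proof (intro ballI; elim imageE)
    fix A B P Q assume AB: "A = ?L P" "P \<in> \<G>" "B = ?L Q" "Q \<in> \<G>"
    have "convex hull P \<inter> convex hull Q \<subseteq> convex hull (P \<inter> Q)"
    proof (cases "convex hull P \<inter> convex hull Q = {}")
      case False
      then obtain S where "S \<subseteq> P" "S \<subseteq> Q" "convex hull P \<inter> convex hull Q = convex hull S"
        using conf AB unfolding conforming_triangulation_def by meson
      then show ?thesis using hull_mono[of S "P \<inter> Q" convex] by simp
    qed simp
    \<comment> \<open>The color depends on the point alone, so common points carry common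
      labels.\<close>
    moreover have "?L P \<inter> ?L Q = ?L (P \<inter> Q)" by auto
    ultimately show "hull_of A \<inter> hull_of B \<subseteq> hull_of (A \<inter> B)"
      unfolding AB by (simp only: hull_of_labelled)
  qed
  then show ?thesis
    using props N0 dim conf
    by unfold_locales (auto simp: initial_labelled_def conforming_triangulation_def)
qed

lemma diameter_le_circum_diam:
  fixes K :: "'a::euclidean_space set"
  assumes "bounded K" "K \<noteq> {}"
  shows "diameter K \<le> circum_diam K"
proof -
  obtain x \<rho> where "K \<subseteq> cball x \<rho>" using assms bounded_subset_cball by blast
  then have "{\<rho>. \<exists>x. K \<subseteq> cball x \<rho>} \<noteq> {}" by blast
  moreover have "diameter K / 2 \<le> \<rho>" if "K \<subseteq> cball x \<rho>" for x \<rho>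
  proof -
    have "\<rho> \<ge> 0" using that assms by fastforce
    then show ?thesis using diameter_subset[OF that] by simp
  qed
  ultimately have "diameter K / 2 \<le> Inf {\<rho>. \<exists>x. K \<subseteq> cball x \<rho>}" by (intro cInf_greatest) auto
  then show ?thesis by (simp add: circum_diam_def)
qed

lemma measure_ge_shape_reg:
  fixes K :: "'a::euclidean_space set"
  assumes K: "compact K" "interior K \<noteq> {}" and \<gamma>: "shape_reg K \<le> \<gamma>" and d: "0 < d" "d \<le> diameter K"
  shows "0 < \<gamma> \<and> unit_ball_vol (real DIM('a)) * (d / (4 * \<gamma>)) ^ DIM('a) \<le> measure lebesgue K"
proof -
  let ?R = "{\<rho>. \<exists>x. cball x \<rho> \<subseteq> K}"
  have bK: "bounded K" using K compact_imp_bounded by blast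
  obtain x e where xe: "0 < e" "cball x e \<subseteq> K" using K(2) by (meson ex_in_conv mem_interior_cball)
  obtain b where b: "\<And>p q. p \<in> K \<Longrightarrow> q \<in> K \<Longrightarrow> dist p q \<le> b" using bounded_two_points[of K] bK by blast
  have bdd: "bdd_above ?R"
  proof (rule bdd_aboveI)
    fix \<rho> assume "\<rho> \<in> ?R"
    then obtain z where z: "cball z \<rho> \<subseteq> K" by blast
    show "\<rho> \<le> max 0 b"
    proof (cases "0 \<le> \<rho>")
      case True
      obtain u :: 'a where "norm u = \<rho>" using True vector_choose_size by blast
      then have "z \<in> K" "z + u \<in> K" using z True by (auto simp: dist_norm)
      then show ?thesis using b[of z "z + u"] \<open>norm u = \<rho>\<close> by (simp add: dist_norm)
    qed simp
  qed
  have "e \<le> Sup ?R" by (rule cSup_upper[OF _ bdd]) (use xe in blast)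
  then have i: "0 < in_diam K" using xe by (simp add: in_diam_def)
  have "d \<le> circum_diam K" using diameter_le_circum_diam[OF bK] K(2) d interior_subset by fastforce
  also have "\<dots> \<le> \<gamma> * in_diam K" using \<gamma> i by (simp add: shape_reg_def divide_le_eq)
  finally have dg: "d \<le> \<gamma> * in_diam K" .
  then have g: "0 < \<gamma>" using d i by (smt (verit) mult_nonpos_nonneg)
  \<comment> \<open>The supremum of the radii is at least d / (2 \<gamma>). Half of that is strictly
    smaller, so a ball with a larger radius exists without the supremum being attained.\<close>
  have "d / (4 * \<gamma>) < Sup ?R" using dg d g i by (simp add: in_diam_def field_simps)
  then obtain \<rho> where "\<rho> \<in> ?R" "d / (4 * \<gamma>) < \<rho>" using less_cSupD[of ?R] xe(2) by blast
  then obtain z where \<rho>: "cball z \<rho> \<subseteq> K" "d / (4 * \<gamma>) < \<rho>" by blast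
  have pos: "0 \<le> d / (4 * \<gamma>)" using d g by simp
  have "unit_ball_vol (real DIM('a)) * (d / (4 * \<gamma>)) ^ DIM('a) = measure lebesgue (cball z (d / (4 * \<gamma>)))"
    using pos by (simp add: content_cball)
  also have "\<dots> \<le> measure lebesgue K"
    using \<rho> K(1) by (intro measure_mono_fmeasurable) (auto intro: lmeasurable_compact)
  finally show ?thesis using g by blast
qed

theorem theorem3p14:
  fixes dummy :: "'a::euclidean_space"
  assumes "DIM('a) \<ge> 2"
  shows "\<forall>\<rho> \<gamma>0::real. \<exists>C::real. \<forall>(N::nat) (\<Omega>::'a set) \<G>0 (c::'a \<Rightarrow> nat) (d::real) (D::real)
            (Ts :: nat \<Rightarrow> 'a splx set) (Ms :: nat \<Rightarrow> 'a splx set).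
     N \<ge> DIM('a) \<and>
     polyhedral_domain \<Omega> \<and> conforming_triangulation DIM('a) \<G>0 (closure \<Omega>) \<and> colored N \<G>0 c \<and>
     0 < d \<and> d \<le> D \<and> D / d = \<rho> \<and>
     Max (shape_reg ` (\<lambda>P. convex hull P) ` \<G>0) = \<gamma>0 \<and>
     (\<forall>T\<in>TT N (initial_labelled \<G>0 c).
        d * 2 powr (- real_of_int (lev_s N T)) \<le> diameter (hull_of T) \<and>
        diameter (hull_of T) \<le> D * 2 powr (- real_of_int (lev_s N T))) \<and>
     Ts 0 = initial_labelled \<G>0 c \<and>
     (\<forall>l. Ms l \<subseteq> Ts l \<and> refine_marked N (initial_labelled \<G>0 c) (Ts l) (Ms l) (Ts (Suc l)))
     \<longrightarrow> (\<forall>L. real (card (Ts L)) - real (card (Ts 0))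
              \<le> C * real N ^ DIM('a) * (\<Sum>l<L. real (card (Ms l))))"
\<comment> \<open>The leading 4 sums the weights over the levels. 84 = 21 * 4, where 21 N D bounds
  the radius (16 N + 5) D and 4 comes from the inscribed balls of radius d / (4 \<gamma>0); the
  volume of the unit ball cancels.\<close>
proof (intro allI exI[of _ "4 * (84 * \<gamma>0 * \<rho>) ^ DIM('a)" for \<gamma>0 \<rho>] impI; elim conjE)
  fix \<rho> \<gamma>0 :: real and N :: nat and \<Omega> :: "'a set" and \<G>0 and c :: "'a \<Rightarrow> nat" and d D :: real
    and Ts Ms :: "nat \<Rightarrow> 'a splx set" and L :: nat
  let ?T0 = "initial_labelled \<G>0 c" and ?n = "DIM('a)"
  let ?V = "unit_ball_vol (real ?n)"
  assume N: "?n \<le> N" and dom: "polyhedral_domain \<Omega>"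
    and conf: "conforming_triangulation ?n \<G>0 (closure \<Omega>)" and col: "colored N \<G>0 c"
    and d: "0 < d" and dD: "d \<le> D" and \<rho>: "D / d = \<rho>"
    and \<gamma>: "Max (shape_reg ` (\<lambda>P. convex hull P) ` \<G>0) = \<gamma>0"
    and diam: "\<forall>T\<in>TT N ?T0. d * 2 powr (- real_of_int (lev_s N T)) \<le> diameter (hull_of T) \<and>
        diameter (hull_of T) \<le> D * 2 powr (- real_of_int (lev_s N T))"
    and Ts0: "Ts 0 = ?T0"
    and step: "\<forall>l. Ms l \<subseteq> Ts l \<and> refine_marked N ?T0 (Ts l) (Ms l) (Ts (Suc l))"
  define c0 where "c0 = ?V * (d / (4 * \<gamma>0)) ^ ?n"
  interpret initial_mesh N ?T0 by (rule initial_labelled_mesh[OF assms N conf col])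
  have vol: "0 < \<gamma>0 \<and> c0 \<le> vol T" if T: "T \<in> ?T0" for T
  proof -
    obtain P where P: "P \<in> \<G>0" "hull_of T = convex hull P"
      using T by (auto simp: initial_labelled_def hull_of_labelled)
    have "finite \<G>0" using conf by (simp add: conforming_triangulation_def)
    then have "shape_reg (hull_of T) \<le> \<gamma>0" unfolding \<gamma>[symmetric] P(2) using P(1) by (intro Max_ge) auto
    moreover have "T \<in> TT N ?T0" using T BB.init by (auto simp: TT_def)
    then have "d \<le> diameter (hull_of T)" using diam lev_init[OF T] by force
    moreover have "compact (hull_of T)"
      unfolding hull_of_def using goodD(1)[OF good_init[OF T]] by (intro finite_imp_compact_convex_hull) auto
    moreover have "interior (hull_of T) \<noteq> {}" using good_not_negligible(1)[OF good_init[OF T]] .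
    ultimately show ?thesis unfolding vol_def c0_def using measure_ge_shape_reg d by blast
  qed
  \<comment> \<open>A nonempty domain provides an initial simplex, and its shape regularity makes
    \<gamma>0, hence \<open>c0\<close>, positive.\<close>
  have "closure \<Omega> \<noteq> {}" using dom by (simp add: polyhedral_domain_def)
  moreover have "\<Union> ((\<lambda>P. convex hull P) ` \<G>0) = closure \<Omega>"
    using conf by (simp add: conforming_triangulation_def)
  ultimately have "\<G>0 \<noteq> {}" by (metis Union_empty image_empty)
  then have \<gamma>_pos: "0 < \<gamma>0" using vol by (auto simp: initial_labelled_def)
  have c0: "0 < c0" using d \<gamma>_pos by (simp add: c0_def)
  interpret adaptive_loop N ?T0 d D c0 Ts Ms
    by unfold_locales (use d dD diam c0 vol Ts0 step in \<open>auto simp: msize_def\<close>)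
  have N1: "1 \<le> real N" using N_pos by simp
  have "2 * \<beta> + 3 * D = 16 * real N * D + 5 * D" by (simp add: \<beta>_def)
  also have "\<dots> \<le> 16 * real N * D + 5 * (real N * D)" using N1 D_pos by simp
  also have "\<dots> = 21 * real N * D" by simp
  finally have R: "2 * \<beta> + 3 * D \<le> 21 * real N * D" .
  have "?V * (2 * \<beta> + 3 * D) ^ ?n / c0 = ((2 * \<beta> + 3 * D) / (d / (4 * \<gamma>0))) ^ ?n"
  proof -
    have "?V \<noteq> 0" using unit_ball_vol_pos[of "real ?n"] by linarith
    show ?thesis
      unfolding c0_def power_divide mult_divide_mult_cancel_left[OF \<open>?V \<noteq> 0\<close>] ..
  qed
  also have "\<dots> \<le> (21 * real N * D / (d / (4 * \<gamma>0))) ^ ?n"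
    using R \<beta>_pos D_pos d \<gamma>_pos by (intro power_mono divide_right_mono) auto
  also have "21 * real N * D / (d / (4 * \<gamma>0)) = (84 * \<gamma>0 * \<rho>) * real N"
    using \<rho> d \<gamma>_pos by (auto simp: field_simps)
  finally have "4 * (?V * (2 * \<beta> + 3 * D) ^ ?n / c0) \<le> 4 * (84 * \<gamma>0 * \<rho>) ^ ?n * real N ^ ?n"
    by (simp add: power_mult_distrib)
  then have "4 * (?V * (2 * \<beta> + 3 * D) ^ ?n / c0) * (\<Sum>l<L. real (card (Ms l))) \<le>
      4 * (84 * \<gamma>0 * \<rho>) ^ ?n * real N ^ ?n * (\<Sum>l<L. real (card (Ms l)))"
    by (intro mult_right_mono sum_nonneg) auto
  then show "real (card (Ts L)) - real (card (Ts 0)) \<le>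
      4 * (84 * \<gamma>0 * \<rho>) ^ ?n * real N ^ ?n * (\<Sum>l<L. real (card (Ms l)))"
    using card_le_marked[of L] by linarith
qed

end
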